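(* For positive integers $k$ and $d$, let $$n_k(d):=\max\{|V(G)| : G \text{ a graph with } \Delta(G)\le d \text{ and } \operatorname{diam} G\le k\}.$$ Then for every fixed positive integer $k$, $$\lim_{d\to\infty}\frac{n_k(d)}{d^k}=1.$$
   Context: Graphs are finite, simple and undirected. $V(G)$ is the vertex set of $G$ and $\Delta(G)$ its maximum degree. $\operatorname{diam} G$ is the maximum graph distance between two vertices of $G$; a disconnected graph has infinite diameter. The limit is over all positive integers $d\to\infty$. *)

theory Defs
  imports "HOL-Analysis.Analysis" "Graph_Theory.Graph_Theory"
begin

text \<open>
  A finite simple undirected graph is a \<^locale>\<open>pair_graph\<close>: finite vertex set, and a
  symmetric, irreflexive set of ordered pairs as adjacency relation.  The undirected edge
  between u and v is represented by the two arcs (u, v) and (v, u), so the degree of a vertex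
  is its out-degree.
\<close>

definition max_degree :: "'a pair_pre_digraph \<Rightarrow> nat" where
  "max_degree G = Max {out_degree (with_proj G) v | v. v \<in> pverts G}"

text \<open>
  The distance is the least length of a walk (unit arc weights), which is \<open>\<infinity>\<close> if there is
  no walk; hence a disconnected graph has diameter \<open>\<infinity>\<close>.
\<close>

definition graph_dist :: "'a pair_pre_digraph \<Rightarrow> 'a \<Rightarrow> 'a \<Rightarrow> ereal" where
  "graph_dist G u v = wf_digraph.\<mu> (with_proj G) (\<lambda>_. 1) u v"

definition graph_diam :: "'a pair_pre_digraph \<Rightarrow> ereal" where
  "graph_diam G = Max {graph_dist G u v | u v. u \<in> pverts G \<and> v \<in> pverts G}"

text \<open>
  Every finite graph is isomorphic to one whose vertices are natural numbers.  The null graph is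
  excluded because the maxima above range over the empty set for it; it cannot affect the
  largest order, as the one-vertex graph always qualifies.  The set below is finite by the
  Moore bound.
\<close>

definition degree_diameter_number :: "nat \<Rightarrow> nat \<Rightarrow> nat" where
  "degree_diameter_number k d =
     Max {card (pverts G) | G :: nat pair_pre_digraph.
            pair_graph G \<and> pverts G \<noteq> {} \<and> max_degree G \<le> d \<and> graph_diam G \<le> ereal (real k)}"

end

theory Submission
  imports Defs "HOL-Algebra.Product_Groups" "HOL-Algebra.Elementary_Groups"
    "HOL-Number_Theory.Cong" "HOL-Real_Asymp.Real_Asymp"
begin

text \<open>
  The upper bound is the Moore bound.  For the lower bound let \<open>p\<close> be a prime, \<open>n = k + 1\<close>, and
  call even (odd) part of a full flag of subspaces of \<open>\<bbbF>\<^sub>p\<^sup>n\<close> its members of even (odd) dimension.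
  Two flags can be joined by \<open>n\<close> moves that alternately change the odd part and the even part:
  this is odd-even transposition sort, which sorts \<open>n\<close> items in \<open>n\<close> rounds.  So an even part
  is joined to any even part (\<open>k\<close> even) or any odd part (\<open>k\<close> odd) by a walk of length \<open>k\<close> in the
  incidence graph of even and odd parts, and vice versa.  Hence any two pairs (even part, odd part)
  are joined by a walk of length \<open>k\<close> if \<open>(x, y)\<close> and \<open>(x', y')\<close> are adjacent whenever \<open>x\<close> is
  incident with \<open>y'\<close> and \<open>x'\<close> with \<open>y\<close>.  This graph has degree at most \<open>(p + 1)\<^sup>k\<close> and about
  \<open>p\<close> to the power \<open>k\<^sup>2\<close> vertices.  For a fixed large \<open>p\<close>, all large degrees \<open>d\<close> are reached from
  it by a blow-up with \<open>(\<int>/q)\<^sup>k\<close>, which multiplies the degree by about \<open>q\<close> and the number of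
  vertices by \<open>q\<^sup>k\<close>.
\<close>

section \<open>Flags in elementary abelian groups\<close>

locale elementary_abelian_group = comm_group G for G (structure) +
  fixes p n :: nat
  assumes prime_p: "prime p"
    and finite_carrier: "finite (carrier G)"
    and card_carrier: "card (carrier G) = p ^ n"
    and pow_p: "x \<in> carrier G \<Longrightarrow> x [^] p = \<one>"
begin

section \<open>Adjoining one element to a subgroup\<close>

lemma p_gt_1: "p > 1" using prime_p prime_gt_1_nat by blast

lemma finite_subgroup: "subgroup H G \<Longrightarrow> finite H"
  using finite_carrier finite_subset subgroup.subset by blast

lemma nat_pow_mod: "x \<in> carrier G \<Longrightarrow> x [^] (i mod p) = x [^] i"
proof -
  assume x: "x \<in> carrier G"
  have "x [^] i = x [^] (p * (i div p) + i mod p)" by simp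
  also have "\<dots> = (x [^] p) [^] (i div p) \<otimes> x [^] (i mod p)"
    using x by (simp only: nat_pow_mult nat_pow_pow)
  also have "\<dots> = x [^] (i mod p)" using x by (simp add: pow_p)
  finally show ?thesis by simp
qed

text \<open>The subgroup generated by \<open>K\<close> and \<open>v\<close>. Exponents stay below
  \<open>p\<close> so that for \<open>v\<close> outside \<open>K\<close> each element is written in
  exactly one way.\<close>

definition adjoin :: "'a set \<Rightarrow> 'a \<Rightarrow> 'a set" where
  "adjoin K v = (\<lambda>(k, i). k \<otimes> v [^] i) ` (K \<times> {..<p})"

lemma adjoinI: "k \<in> K \<Longrightarrow> v \<in> carrier G \<Longrightarrow> k \<otimes> v [^] (i::nat) \<in> adjoin K v"
  unfolding adjoin_def using nat_pow_mod[of v i] p_gt_1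
  by (intro image_eqI[of _ _ "(k, i mod p)"]) auto

lemma adjoinE:
  assumes "x \<in> adjoin K v"
  obtains k and i :: nat where "k \<in> K" "i < p" "x = k \<otimes> v [^] i"
  using assms unfolding adjoin_def by auto

lemma subset_adjoin:
  assumes K: "subgroup K G" and v: "v \<in> carrier G"
  shows "K \<subseteq> adjoin K v" "v \<in> adjoin K v"
proof -
  show "K \<subseteq> adjoin K v"
  proof
    fix k assume "k \<in> K"
    then show "k \<in> adjoin K v"
      using adjoinI[of k K v 0] v subgroup.mem_carrier[OF K] by simp
  qed
  show "v \<in> adjoin K v"
    using adjoinI[of \<one> K v 1] v subgroup.one_closed[OF K] by simp
qed

lemma subgroup_adjoin:
  assumes K: "subgroup K G" and v: "v \<in> carrier G"
  shows "subgroup (adjoin K v) G"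
proof (rule subgroupI)
  show "adjoin K v \<subseteq> carrier G"
    using v subgroup.mem_carrier[OF K] by (auto elim!: adjoinE)
  show "adjoin K v \<noteq> {}" using subset_adjoin[OF assms] by blast
  fix x assume x: "x \<in> adjoin K v"
  then obtain k and i :: nat where k: "k \<in> K" "x = k \<otimes> v [^] i"
    by (auto elim!: adjoinE)
  have kc: "k \<in> carrier G" using k subgroup.mem_carrier[OF K] by auto
  have "v [^] i \<otimes> v [^] ((p - 1) * i) = v [^] (p * i)"
    using v p_gt_1 by (simp add: nat_pow_mult diff_mult_distrib)
  also have "\<dots> = \<one>" using v pow_p by (simp add: nat_pow_pow[symmetric])
  finally have "inv (v [^] i) = v [^] ((p - 1) * i)"
    using v by (metis inv_equality m_comm nat_pow_closed)
  then have "inv x = inv k \<otimes> v [^] ((p - 1) * i)"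
    using k kc v by (simp add: inv_mult)
  then show "inv x \<in> adjoin K v"
    using adjoinI subgroup.m_inv_closed[OF K] k v by simp
  fix y assume "y \<in> adjoin K v"
  then obtain l and j :: nat where l: "l \<in> K" "y = l \<otimes> v [^] j"
    by (auto elim!: adjoinE)
  have "l \<in> carrier G" using l subgroup.mem_carrier[OF K] by auto
  then have "x \<otimes> y = (k \<otimes> l) \<otimes> v [^] (i + j)"
    using k l kc v by (simp add: nat_pow_mult[symmetric] m_ac)
  then show "x \<otimes> y \<in> adjoin K v"
    using adjoinI[of "k \<otimes> l" K v "i + j"] subgroup.m_closed[OF K] k l v by simp
qed

lemma adjoin_least:
  assumes H: "subgroup H G" and "K \<subseteq> H" "v \<in> H"
  shows "adjoin K v \<subseteq> H"
proof
  fix x assume "x \<in> adjoin K v"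
  then obtain k i where *: "k \<in> K" "x = k \<otimes> v [^] (i::nat)" by (auto elim: adjoinE)
  have "v [^] i \<in> H"
    using subgroup.m_closed[OF H] subgroup.one_closed[OF H] \<open>v \<in> H\<close> by (induction i) auto
  then show "x \<in> H" using * assms subgroup.m_closed[OF H] by auto
qed

text \<open>If two representations agreed, some \<open>v [^] i\<close> with \<open>0 < i < p\<close>
  would lie in \<open>K\<close>; as \<open>i\<close> is invertible modulo \<open>p\<close>, so would
  \<open>v\<close>.\<close>

lemma card_adjoin:
  assumes K: "subgroup K G" and v: "v \<in> carrier G" "v \<notin> K"
  shows "card (adjoin K v) = p * card K"
proof -
  have nz: "v [^] i \<notin> K" if i: "0 < i" "i < p" for i :: nat
  proof
    assume vi: "v [^] i \<in> K"
    have "coprime i p"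
      using i prime_p by (metis coprime_commute nat_dvd_not_less prime_imp_coprime_nat)
    then obtain m where m: "[i * m = 1] (mod p)" using cong_solve_coprime_nat by auto
    have "v [^] (i * m) = v [^] (1::nat)"
      using m nat_pow_mod[OF v(1)] unfolding unique_euclidean_semiring_class.cong_def by metis
    moreover have "(v [^] i) [^] m \<in> K"
      using subgroup.m_closed[OF K] subgroup.one_closed[OF K] vi by (induction m) auto
    ultimately show False using v by (simp add: nat_pow_pow)
  qed
  \<comment> \<open>Only one inequality is derived; exchanging the two representations gives the
    other.\<close>
  have *: "j \<le> i" if kl: "k \<in> K" "l \<in> K" "i < p" "j < p"
    and eq: "k \<otimes> v [^] i = l \<otimes> v [^] j" for k l and i j :: nat
  proof (rule ccontr)
    assume "\<not> j \<le> i"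
    then have j: "j = i + (j - i)" "0 < j - i" "j - i < p" using kl by auto
    have kc: "k \<in> carrier G" "l \<in> carrier G" using kl subgroup.mem_carrier[OF K] by auto
    have "k \<otimes> v [^] i = (l \<otimes> v [^] (j - i)) \<otimes> v [^] i"
      using eq j(1) kc v by (metis add.commute m_assoc nat_pow_closed nat_pow_mult)
    then have "k = l \<otimes> v [^] (j - i)" using kc v by (simp add: right_cancel)
    then have "v [^] (j - i) = inv l \<otimes> k" using kc v by (simp add: inv_solve_left)
    then have "v [^] (j - i) \<in> K"
      using kl subgroup.m_closed[OF K] subgroup.m_inv_closed[OF K] by auto
    then show False using nz j by blast
  qed
  have "inj_on (\<lambda>(k, i). k \<otimes> v [^] i) (K \<times> {..<p})"
  proof (rule inj_onI, clarsimp)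
    fix k i l j assume a: "k \<in> K" "l \<in> K" "i < p" "j < p" "k \<otimes> v [^] i = l \<otimes> v [^] j"
    have "i = j" using *[OF a] *[OF a(2,1,4,3) a(5)[symmetric]] by simp
    moreover have "k = l"
      using a \<open>i = j\<close> v subgroup.mem_carrier[OF K] by (simp add: right_cancel)
    ultimately show "k = l \<and> i = j" by simp
  qed
  then show ?thesis
    unfolding adjoin_def by (simp add: card_image card_cartesian_product mult.commute)
qed

lemma card_subgroup_pos: "subgroup H G \<Longrightarrow> card H > 0"
  using finite_subgroup subgroup.one_closed by (metis card_gt_0_iff empty_iff)

text \<open>Adjoining \<open>v\<close> already produces \<open>p * card K\<close> elements inside
  \<open>H\<close>, so nothing of \<open>H\<close> is left over.\<close>

lemma eq_adjoin:
  assumes "subgroup K G" "subgroup H G" "K \<subseteq> H" "card H = p * card K" "v \<in> H - K"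
  shows "H = adjoin K v"
  using assms card_adjoin[of K v] adjoin_least[of H K v] finite_subgroup
    subgroup.mem_carrier[of H G v]
  by (metis DiffD1 DiffD2 card_subset_eq)

section \<open>Indices and intersections\<close>

text \<open>An element \<open>v\<close> of \<open>H \<inter> B\<close> outside \<open>K\<close>
  generates \<open>H\<close> over \<open>K\<close>. If \<open>w = k \<otimes> v [^] i\<close> is in
  \<open>B\<close>, so is \<open>k\<close>; hence \<open>v\<close> also generates
  \<open>H \<inter> B\<close> over \<open>K \<inter> B\<close>.\<close>

lemma card_Int_adjacent:
  assumes K: "subgroup K G" and H: "subgroup H G" and B: "subgroup B G"
    and KH: "K \<subseteq> H" "card H = p * card K"
  shows "card (H \<inter> B) \<le> p * card (K \<inter> B)"
proof (cases "H \<inter> B \<subseteq> K")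
  case True
  then have "card (H \<inter> B) \<le> card (K \<inter> B)"
    using finite_subgroup[OF K] by (intro card_mono) auto
  also have "\<dots> \<le> p * card (K \<inter> B)" using p_gt_1 by simp
  finally show ?thesis .
next
  case False
  then obtain v where v: "v \<in> H" "v \<in> B" "v \<notin> K" by blast
  have vc: "v \<in> carrier G" using v subgroup.mem_carrier[OF H] by blast
  have "H \<inter> B \<subseteq> adjoin (K \<inter> B) v"
  proof
    fix w assume w: "w \<in> H \<inter> B"
    have "H = adjoin K v" using eq_adjoin[OF K H KH] v by blast
    with w obtain k i where k: "k \<in> K" "w = k \<otimes> v [^] (i::nat)" by (auto elim: adjoinE)
    have vi: "v [^] i \<in> B"
      using subgroup.m_closed[OF B] subgroup.one_closed[OF B] v by (induction i) auto
    have "k = w \<otimes> inv (v [^] i)"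
      using k vc subgroup.mem_carrier[OF K] by (simp add: inv_solve_right)
    then have "k \<in> B"
      using w vi subgroup.m_closed[OF B] subgroup.m_inv_closed[OF B] by auto
    then show "w \<in> adjoin (K \<inter> B) v" using k vc adjoinI by auto
  qed
  then have "card (H \<inter> B) \<le> card (adjoin (K \<inter> B) v)"
    using finite_subgroup subgroup_adjoin[OF subgroups_Inter_pair[OF K B] vc] by (meson card_mono)
  also have "\<dots> = p * card (K \<inter> B)"
    using card_adjoin[OF subgroups_Inter_pair[OF K B] vc] v by simp
  finally show ?thesis .
qed

lemma card_strict_subgroup:
  assumes K: "subgroup K G" and H: "subgroup H G" and KH: "K \<subset> H"
  shows "p * card K \<le> card H"
proof -
  obtain v where v: "v \<in> H" "v \<notin> K" using KH by blast
  then have "v \<in> carrier G" using subgroup.mem_carrier[OF H] by blast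
  then have "p * card K = card (adjoin K v)" using card_adjoin[OF K] v by simp
  also have "\<dots> \<le> card H"
    using adjoin_least[OF H] KH v finite_subgroup[OF H] by (intro card_mono) auto
  finally show ?thesis .
qed

text \<open>One comparator of the sorting network: \<open>J\<close> is \<open>K\<close> with an element adjoined that comes from
  the smallest \<open>B i\<close> in which \<open>K\<close> and \<open>H\<close> differ.\<close>

lemma gate:
  assumes K: "subgroup K G" and H: "subgroup H G" and KH: "K \<subset> H"
    and B: "\<And>i. i \<le> m \<Longrightarrow> subgroup (B i) G"
    and mono: "\<And>i. i < m \<Longrightarrow> B i \<subseteq> B (Suc i)"
    and top: "B m = carrier G"
  obtains J where "subgroup J G" "K \<subseteq> J" "J \<subseteq> H" "card J = p * card K"
    "\<And>i. i \<le> m \<Longrightarrow> min (p * card (K \<inter> B i)) (card (H \<inter> B i)) \<le> card (J \<inter> B i)"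
proof -
  define a where "a = (LEAST i. \<not> H \<inter> B i \<subseteq> K)"
  have "\<not> H \<inter> B m \<subseteq> K" using top KH subgroup.subset[OF H] by auto
  then have a: "\<not> H \<inter> B a \<subseteq> K" "a \<le> m"
    unfolding a_def by (rule LeastI, rule Least_le)
  have below: "H \<inter> B i \<subseteq> K" if "i < a" for i
    using that not_less_Least unfolding a_def by blast
  obtain v where v: "v \<in> H" "v \<in> B a" "v \<notin> K" using a by blast
  have vc: "v \<in> carrier G" using v subgroup.mem_carrier[OF H] by blast
  define J where "J = adjoin K v"
  have J: "subgroup J G" "K \<subseteq> J" "v \<in> J"
    using subgroup_adjoin[OF K vc] subset_adjoin[OF K vc] by (auto simp: J_def)
  have JH: "J \<subseteq> H" unfolding J_def using adjoin_least[OF H] KH v by blast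
  have le: "B i \<subseteq> B j" if "i \<le> j" "j \<le> m" for i j
    using that by (induction j rule: dec_induct) (use mono in \<open>auto simp: Suc_le_eq\<close>)
  have *: "min (p * card (K \<inter> B i)) (card (H \<inter> B i)) \<le> card (J \<inter> B i)" if i: "i \<le> m" for i
  \<comment> \<open>Below level \<open>a\<close> all that \<open>H\<close> shares with
    \<open>B i\<close> is in \<open>K\<close>, hence in \<open>J\<close>. From \<open>a\<close> on,
    \<open>v\<close> enlarges \<open>K \<inter> B i\<close>, and then by a factor of at least
    \<open>p\<close>.\<close>
  proof (cases "i < a")
    case True
    have "H \<inter> B i \<subseteq> J \<inter> B i" using below[OF True] J by auto
    then have "card (H \<inter> B i) \<le> card (J \<inter> B i)"
      using finite_subgroup[OF J(1)] by (intro card_mono) auto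
    then show ?thesis by simp
  next
    case False
    then have "K \<inter> B i \<subset> J \<inter> B i" using le[of a i] i v J by auto
    then have "p * card (K \<inter> B i) \<le> card (J \<inter> B i)"
      using card_strict_subgroup subgroups_Inter_pair K J B i by metis
    then show ?thesis by simp
  qed
  show ?thesis
    using that[of J] J JH * card_adjoin[OF K vc v(3)] unfolding J_def by blast
qed

section \<open>Counting minimal extensions of a subgroup\<close>

text \<open>The subspaces of \<open>H\<close> one dimension above \<open>K\<close>, in other words
  the points of the projective space of \<open>H / K\<close>.\<close>

definition between :: "'a set \<Rightarrow> 'a set \<Rightarrow> 'a set set" where
  "between K H = {J. subgroup J G \<and> K \<subseteq> J \<and> J \<subseteq> H \<and> card J = p * card K}"

lemma finite_between: "finite (between K H)"
proof (rule finite_subset)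
  show "between K H \<subseteq> Pow (carrier G)"
    by (auto simp: between_def dest: subgroup.mem_carrier)
qed (simp add: finite_carrier)

text \<open>By \<open>eq_adjoin\<close> a single element outside \<open>K\<close> determines the
  extension.\<close>

lemma between_disjoint:
  assumes "subgroup K G" "J \<in> between K H" "J' \<in> between K H" "J \<noteq> J'"
  shows "(J - K) \<inter> (J' - K) = {}"
proof -
  have "J = J'" if "v \<in> J - K" "v \<in> J' - K" for v
  proof -
    have "J = adjoin K v" "J' = adjoin K v"
      using assms(2,3) that eq_adjoin[OF assms(1), of J v] eq_adjoin[OF assms(1), of J' v]
      by (simp_all add: between_def)
    then show ?thesis by simp
  qed
  then show ?thesis using assms by blast
qed

lemma card_between_Diff:
  assumes "subgroup K G" "J \<in> between K H"
  shows "card (J - K) = (p - 1) * card K"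
  using assms finite_subgroup
  by (simp add: between_def card_Diff_subset diff_mult_distrib)

text \<open>The disjoint sets \<open>J - K\<close>, of size \<open>(p - 1) * card K\<close> each,
  fit into \<open>H - K\<close>, of size \<open>(p * p - 1) * card K\<close>: a projective line has
  \<open>p + 1\<close> points.\<close>

lemma card_between_le:
  assumes K: "subgroup K G" and H: "subgroup H G" "K \<subseteq> H" "card H = p * (p * card K)"
  shows "card (between K H) \<le> p + 1"
proof -
  have "card (between K H) * ((p - 1) * card K) = (\<Sum>J\<in>between K H. card (J - K))"
    using card_between_Diff[OF K, of _ H] by simp
  also have "\<dots> = card (\<Union>J\<in>between K H. J - K)"
    using between_disjoint[OF K, of _ H] finite_between finite_subgroup
    by (intro card_UN_disjoint[symmetric]) (auto simp: between_def)
  also have "\<dots> \<le> card (H - K)"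
    using finite_subgroup[OF H(1)] by (intro card_mono) (auto simp: between_def)
  also have "\<dots> = (p + 1) * ((p - 1) * card K)"
    using H finite_subgroup[OF K] by (simp add: card_Diff_subset algebra_simps diff_mult_distrib2)
  finally show ?thesis
    using p_gt_1 card_subgroup_pos[OF K] by (subst (asm) mult_le_cancel2) auto
qed

text \<open>The sets \<open>J - K\<close> cover the complement of \<open>K\<close>, which has
  \<open>p ^ n - p ^ m\<close> elements.\<close>

lemma card_extensions_ge:
  assumes K: "subgroup K G" and m: "card K = p ^ m" "m < n"
  shows "p ^ (n - Suc m) \<le> card (between K (carrier G))"
proof -
  let ?E = "between K (carrier G)"
  have "carrier G - K \<subseteq> (\<Union>J\<in>?E. J - K)"
  proof
    fix v assume v: "v \<in> carrier G - K"
    then have "adjoin K v \<in> ?E"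
      using subgroup_adjoin[OF K] subset_adjoin[OF K] card_adjoin[OF K]
        subgroup.subset[OF subgroup_adjoin[OF K]] by (auto simp: between_def)
    then show "v \<in> (\<Union>J\<in>?E. J - K)" using v subset_adjoin[OF K] by blast
  qed
  then have "card (carrier G - K) \<le> card (\<Union>J\<in>?E. J - K)"
    using finite_between[of K "carrier G"] finite_subgroup
    by (intro card_mono finite_UN_I finite_Diff) (simp_all add: between_def)
  also have "\<dots> \<le> (\<Sum>J\<in>?E. card (J - K))" using finite_between by (rule card_UN_le)
  also have "\<dots> = card ?E * (p - 1) * p ^ m"
    using card_between_Diff[OF K, of _ "carrier G"] m by simp
  finally have le: "p ^ n - p ^ m \<le> card ?E * (p - 1) * p ^ m"
    by (simp only: card_Diff_subset[OF finite_subgroup[OF K] subgroup.subset[OF K]] m card_carrier)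
  define r where "r = n - Suc m"
  have n: "n = r + 1 + m" using m by (simp add: r_def)
  \<comment> \<open>Replaces the exact quotient \<open>(p ^ (r + 1) - 1) / (p - 1)\<close> by its
    leading term \<open>p ^ r\<close>.\<close>
  have "(p - 1) * p ^ r * p ^ m \<le> (p ^ (r + 1) - 1) * p ^ m"
  proof (rule mult_right_mono)
    show "(p - 1) * p ^ r \<le> p ^ (r + 1) - 1"
      using p_gt_1 diff_le_mono2[of 1 "p ^ r" "p * p ^ r"] by (simp add: diff_mult_distrib)
  qed simp
  also have "\<dots> = p ^ n - p ^ m"
    by (simp add: n power_add diff_mult_distrib)
  finally have "p ^ r * ((p - 1) * p ^ m) \<le> card ?E * ((p - 1) * p ^ m)"
    using le by (simp only: mult_ac)
  then show ?thesis using p_gt_1 by (subst (asm) mult_le_cancel2) (simp add: r_def)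
qed

text \<open>Over a prime field subspaces are just additive subgroups, so no scalars occur.\<close>

definition flag :: "(nat \<Rightarrow> 'a set) \<Rightarrow> bool" where
  "flag F \<longleftrightarrow> F \<in> extensional {..n} \<and> (\<forall>j\<le>n. subgroup (F j) G \<and> card (F j) = p ^ j)
     \<and> (\<forall>j<n. F j \<subseteq> F (Suc j))"

lemma flagD:
  assumes "flag F" "j \<le> n"
  shows "subgroup (F j) G" "card (F j) = p ^ j" "j < n \<Longrightarrow> F j \<subseteq> F (Suc j)"
  using assms by (auto simp: flag_def)

lemma flag_top:
  assumes "flag F"
  shows "F n = carrier G"
  using flagD[OF assms, of n] card_carrier
  by (intro card_subset_eq[OF finite_carrier] subgroup.subset) auto

lemma flag_bot:
  assumes "flag F"
  shows "F 0 = {\<one>}"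
proof -
  have F: "subgroup (F 0) G" "card (F 0) = 1" using flagD[OF assms, of 0] by auto
  obtain x where "F 0 = {x}" using card_1_singletonE[OF F(2)] by blast
  then show ?thesis using subgroup.one_closed[OF F(1)] by simp
qed

section \<open>Sorting one flag into another\<close>

text \<open>Going down from \<open>A n\<close>, the whole group, each step costs at most a factor
  \<open>p\<close> by \<open>card_Int_adjacent\<close>. In dimensions:
  \<open>dim (A j \<inter> B i) \<ge> i + j - n\<close>, written without a truncated difference of
  \<open>i + j\<close> and \<open>n\<close>.\<close>

lemma card_flag_Int:
  assumes A: "flag A" and B: "flag B" and "i \<le> n" "j \<le> n"
  shows "p ^ i \<le> p ^ (n - j) * card (A j \<inter> B i)"
  using \<open>j \<le> n\<close>
proof (induction j rule: inc_induct)
  case base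
  have "A n \<inter> B i = B i"
    using flag_top[OF A] subgroup.subset[OF flagD(1)[OF B \<open>i \<le> n\<close>]] by auto
  then show ?case using flagD(2)[OF B \<open>i \<le> n\<close>] by simp
next
  case (step j)
  have "p ^ i \<le> p ^ (n - Suc j) * card (A (Suc j) \<inter> B i)" by (rule step)
  also have "\<dots> \<le> p ^ (n - Suc j) * (p * card (A j \<inter> B i))"
    using flagD[OF A, of j] flagD[OF A, of "Suc j"] flagD[OF B \<open>i \<le> n\<close>] step
    by (intro mult_left_mono card_Int_adjacent) auto
  also have "\<dots> = p ^ (n - j) * card (A j \<inter> B i)"
    using step by (simp add: Suc_diff_Suc flip: power_Suc2 mult.assoc)
  finally show ?case .
qed

text \<open>All inner members of one parity are replaced at once by \<open>gate\<close>. The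
  neighbours of a replaced member stay, so the replacements do not interfere. \<open>b\<close> says
  whether the even members move.\<close>

lemma sort_round:
  assumes C: "flag C" and B: "flag B"
  obtains C' where "flag C'"
    and "\<And>j. j = 0 \<or> n \<le> j \<or> even j \<noteq> b \<Longrightarrow> C' j = C j"
    and "\<And>i j. 0 < j \<Longrightarrow> j < n \<Longrightarrow> even j = b \<Longrightarrow> i \<le> n \<Longrightarrow>
      min (p * card (C (j - 1) \<inter> B i)) (card (C (Suc j) \<inter> B i)) \<le> card (C' j \<inter> B i)"
proof -
  define good where "good j J \<longleftrightarrow> subgroup J G \<and> C (j - 1) \<subseteq> J \<and> J \<subseteq> C (Suc j) \<and> card J = p ^ j \<and>
    (\<forall>i\<le>n. min (p * card (C (j - 1) \<inter> B i)) (card (C (Suc j) \<inter> B i)) \<le> card (J \<inter> B i))" for j J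
  have ex: "\<exists>J. good j J" if j: "0 < j" "j < n" for j
  proof -
    have K: "subgroup (C (j - 1)) G" "card (C (j - 1)) = p ^ (j - 1)" "C (j - 1) \<subseteq> C j"
      using flagD[OF C, of "j - 1"] j by auto
    have H: "subgroup (C (Suc j)) G" "card (C (Suc j)) = p ^ Suc j" "C j \<subseteq> C (Suc j)"
      using flagD[OF C, of "Suc j"] flagD[OF C, of j] j by auto
    have "p ^ (j - 1) < p ^ Suc j" using p_gt_1 by (intro power_strict_increasing) auto
    then have "C (j - 1) \<subset> C (Suc j)" using K H by auto
    then obtain J where "subgroup J G" "C (j - 1) \<subseteq> J" "J \<subseteq> C (Suc j)" "card J = p * card (C (j - 1))"
      "\<And>i. i \<le> n \<Longrightarrow> min (p * card (C (j - 1) \<inter> B i)) (card (C (Suc j) \<inter> B i)) \<le> card (J \<inter> B i)"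
      using gate[OF K(1) H(1), of n B] flagD[OF B] flag_top[OF B] by (metis less_imp_le)
    moreover have "p * p ^ (j - 1) = p ^ j" using j by (cases j) auto
    ultimately show ?thesis unfolding good_def using K(2) by auto
  qed
  define C' where "C' j = (if j = 0 \<or> n \<le> j \<or> even j \<noteq> b then C j else SOME J. good j J)" for j
  have C': "good j (C' j)" if "0 < j" "j < n" "even j = b" for j
    using someI_ex[OF ex[OF that(1,2)]] that by (simp add: C'_def)
  have same: "C' j = C j" if "j = 0 \<or> n \<le> j \<or> even j \<noteq> b" for j
    using that by (auto simp: C'_def)
  have "flag C'"
    unfolding flag_def
  proof (intro conjI allI impI)
    show "C' \<in> extensional {..n}"
      using C same by (auto simp: flag_def extensional_def)
    show "subgroup (C' j) G" "card (C' j) = p ^ j" if "j \<le> n" for j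
      using flagD[OF C that] C'[of j] same[of j] unfolding good_def by (metis leI neq0_conv)+
    show "C' j \<subseteq> C' (Suc j)" if j: "j < n" for j
    proof (cases "even j = b")
      case True
      then have s: "C' (Suc j) = C (Suc j)" using same by auto
      show ?thesis
        using C'[of j] same[of j] flagD(3)[OF C, of j] j True s unfolding good_def by (cases "j = 0") auto
    next
      case False
      then have s: "C' j = C j" using same by auto
      show ?thesis
        using C'[of "Suc j"] same[of "Suc j"] flagD(3)[OF C, of j] j False s unfolding good_def
        by (cases "Suc j = n") auto
    qed
  qed
  moreover have "min (p * card (C (j - 1) \<inter> B i)) (card (C (Suc j) \<inter> B i)) \<le> card (C' j \<inter> B i)"
    if "0 < j" "j < n" "even j = b" "i \<le> n" for i j
    using C'[OF that(1-3)] that(4) by (simp add: good_def)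
  ultimately show ?thesis using that same by blast
qed

text \<open>\<open>n\<close> rounds of \<open>sort_round\<close> with alternating parity, the even
  members moving first if \<open>b\<close> holds. Progress is measured by the sizes of
  \<open>C t j \<inter> B i\<close>. Knowing which members each round keeps is what later yields
  walks.\<close>

lemma flag_sort:
  assumes A: "flag A" and B: "flag B"
  obtains C where "C 0 = A" "C n = B" "\<And>t. flag (C t)"
    "\<And>t j. even j \<noteq> (even t = b) \<Longrightarrow> C (Suc t) j = C t j"
proof -
  define next_flag where "next_flag t C C' \<longleftrightarrow> flag C' \<and>
    (\<forall>j. j = 0 \<or> n \<le> j \<or> even j \<noteq> (even t = b) \<longrightarrow> C' j = C j) \<and>
    (\<forall>i j. 0 < j \<longrightarrow> j < n \<longrightarrow> even j = (even t = b) \<longrightarrow> i \<le> n \<longrightarrow>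
      min (p * card (C (j - 1) \<inter> B i)) (card (C (Suc j) \<inter> B i)) \<le> card (C' j \<inter> B i))"
    for t :: nat and C C'
  have "\<exists>C'. next_flag t C C'" if "flag C" for t C
    using sort_round[OF that B, of "even t = b"] unfolding next_flag_def by metis
  then have f: "next_flag t C (SOME C'. next_flag t C C')" if "flag C" for t C
    using someI_ex that by metis
  define f where "f t C = (SOME C'. next_flag t C C')" for t C
  define C where "C = rec_nat A f"
  have C0: "C 0 = A" and CS: "C (Suc t) = f t (C t)" for t by (simp_all add: C_def)
  have flC: "flag (C t)" for t
    by (induction t) (use A f CS C0 in \<open>auto simp: next_flag_def f_def\<close>)
  have nx: "next_flag t (C t) (C (Suc t))" for t using f[OF flC] CS by (simp add: f_def)
  \<comment> \<open>0-1 principle for the threshold \<open>i\<close>: in the worst case the \<open>m\<close>-th item that belongs to \<open>B i\<close>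
    starts at position \<open>n - i + m\<close> and moves down by one per round, from round \<open>m\<close> or \<open>m + 1\<close>
    on.  Which of the two is decided by parity, and \<open>\<delta>\<close> records it.\<close>
  have inv: "p ^ m \<le> card (C t j \<inter> B i)"
    if "1 \<le> m" "m \<le> i" "m \<le> j" "i \<le> n" "j \<le> n" "n + 2 * m \<le> i + j + t + \<delta>"
      "\<delta> = (if even (Suc (n + i)) = b then 0 else 1)" for m t i j \<delta> :: nat
    using that
  proof (induction t arbitrary: m j)
    case 0
    \<comment> \<open>Since \<open>m \<ge> 1\<close>, one of the two copies of \<open>m\<close>
      absorbs \<open>\<delta>\<close>, which leaves \<open>n - j + m \<le> i\<close>.\<close>
    have "p ^ (n - j) * p ^ m \<le> p ^ i"
      unfolding power_add[symmetric] using 0 p_gt_1 by (intro power_increasing) (auto split: if_splits)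
    also have "\<dots> \<le> p ^ (n - j) * card (A j \<inter> B i)" using card_flag_Int[OF A B] 0 by simp
    finally show ?case using p_gt_1 C0 by simp
  next
    case (Suc t)
    have pm: "p ^ m \<le> p ^ i" using Suc.prems p_gt_1 by (intro power_increasing) auto
    consider "j = n" | "j < n" "even j = (even t = b)" | "j < n" "even j \<noteq> (even t = b)"
      using Suc.prems by linarith
    then show ?case
    proof cases
      case 1
      have "C (Suc t) j \<inter> B i = B i"
        using 1 flag_top[OF flC] flagD(1)[OF B \<open>i \<le> n\<close>] subgroup.subset by blast
      then show ?thesis using flagD(2)[OF B \<open>i \<le> n\<close>] pm by simp
    next
      case 2
      \<comment> \<open>Both arguments of the minimum reach \<open>p ^ m\<close>: the upper
        neighbour gains in \<open>j\<close> what is lost in \<open>t\<close>, the lower one needs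
        only \<open>m - 1\<close> because of the factor \<open>p\<close>. For \<open>m = 1\<close>
        the lower intersection just has to be nonempty.\<close>
      have a: "p ^ m \<le> card (C t (Suc j) \<inter> B i)"
        using 2 Suc.prems by (intro Suc.IH) auto
      have b: "p ^ m \<le> p * card (C t (j - 1) \<inter> B i)"
      proof (cases "m = 1")
        case True
        have "subgroup (C t (j - 1) \<inter> B i) G"
          using flagD(1)[OF flC, of "j - 1" t] flagD(1)[OF B] Suc.prems subgroups_Inter_pair by auto
        then have "card (C t (j - 1) \<inter> B i) > 0" by (rule card_subgroup_pos)
        then show ?thesis using True by simp
      next
        case False
        have "p ^ (m - 1) \<le> card (C t (j - 1) \<inter> B i)"
          using False Suc.prems by (intro Suc.IH) auto
        then have "p * p ^ (m - 1) \<le> p * card (C t (j - 1) \<inter> B i)" by simp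
        then show ?thesis using Suc.prems by (cases m) auto
      qed
      have "min (p * card (C t (j - 1) \<inter> B i)) (card (C t (Suc j) \<inter> B i)) \<le> card (C (Suc t) j \<inter> B i)"
        using nx[of t] 2 Suc.prems unfolding next_flag_def by simp
      then show ?thesis using a b by linarith
    next
      case 3
      \<comment> \<open>This member rests in the round. By the choice of \<open>\<delta>\<close> the
        two sides differ in parity, so the inequality is strict and already holds one round
        earlier.\<close>
      have "n + 2 * m \<noteq> i + j + Suc t + \<delta>"
      proof
        assume "n + 2 * m = i + j + Suc t + \<delta>"
        then have "even (n + 2 * m) = even (i + j + Suc t + \<delta>)" by simp
        then show False using 3(2) Suc.prems(7) by (auto split: if_splits)
      qed
      then have "p ^ m \<le> card (C t j \<inter> B i)" using Suc.prems by (intro Suc.IH) auto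
      then show ?thesis using nx[of t] 3 unfolding next_flag_def by simp
    qed
  qed
  have "C n = B"
  proof
    fix j
    show "C n j = B j"
    proof (cases "0 < j \<and> j \<le> n")
      case True
      \<comment> \<open>For \<open>m = i = j\<close> and \<open>t = n\<close> the condition of
        \<open>inv\<close> is met, and the sizes then force \<open>C n j = B j\<close>.\<close>
      have "p ^ j \<le> card (C n j \<inter> B j)" using True by (intro inv[OF _ _ _ _ _ _ refl]) auto
      then have "C n j \<inter> B j = C n j" "C n j \<inter> B j = B j"
        using flagD[OF flC[of n], of j] flagD[OF B, of j] True finite_subgroup
        by (metis Int_lower1 Int_lower2 card_seteq)+
      then show ?thesis by simp
    next
      case False
      then have "j = 0 \<or> j \<notin> {..n}" by auto
      then show ?thesis
        using flag_bot[OF flC[of n]] flag_bot[OF B] flC[of n] B extensional_arb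
        unfolding flag_def by metis
    qed
  qed
  then show ?thesis using that[of C] C0 flC nx unfolding next_flag_def by blast
qed

subsection \<open>The graph of pairs of partial flags\<close>

definition partial_flags :: "nat \<Rightarrow> (nat \<Rightarrow> 'a set) set" where
  "partial_flags m = {F \<in> extensional {..m}. (\<forall>j\<le>m. subgroup (F j) G \<and> card (F j) = p ^ j)
     \<and> (\<forall>j<m. F j \<subseteq> F (Suc j))}"

lemma flag_iff_partial: "flag F \<longleftrightarrow> F \<in> partial_flags n"
  by (auto simp: flag_def partial_flags_def)

lemma finite_partial_flags: "finite (partial_flags m)"
proof (rule finite_subset)
  show "partial_flags m \<subseteq> {..m} \<rightarrow>\<^sub>E Pow (carrier G)"
  proof
    fix F assume F: "F \<in> partial_flags m"
    show "F \<in> {..m} \<rightarrow>\<^sub>E Pow (carrier G)"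
    proof (rule PiE_I)
      show "F j \<in> Pow (carrier G)" if "j \<in> {..m}" for j
        using F that by (auto simp: partial_flags_def dest: subgroup.mem_carrier)
      show "F j = undefined" if "j \<notin> {..m}" for j
        using F that by (simp add: partial_flags_def extensional_def)
    qed
  qed
qed (simp add: finite_PiE finite_carrier)

text \<open>The last member of a partial flag has at least \<open>p ^ (n - Suc m)\<close> minimal
  extensions by \<open>card_extensions_ge\<close>.\<close>

lemma card_partial_flags_ge:
  "m \<le> n \<Longrightarrow> p ^ (\<Sum>j<m. n - Suc j) \<le> card (partial_flags m)"
proof (induction m)
  case 0
  have "(\<lambda>j\<in>{..0}. {\<one>}) \<in> partial_flags 0"
    using triv_subgroup by (auto simp: partial_flags_def)
  then show ?case using finite_partial_flags by (simp add: Suc_le_eq card_gt_0_iff) blast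
next
  case (Suc m)
  let ?S = "SIGMA F:partial_flags m. between (F m) (carrier G)"
  let ?f = "\<lambda>(F, J). F(Suc m := J)"
  have inj: "inj_on ?f ?S"
  proof (rule inj_onI, clarify)
    fix F J F' J'
    assume F: "F \<in> partial_flags m" "F' \<in> partial_flags m" and eq: "F(Suc m := J) = F'(Suc m := J')"
    \<comment> \<open>\<open>F\<close> and \<open>F'\<close> are both \<open>undefined\<close> at
      \<open>Suc m\<close>, so the update loses nothing.\<close>
    have "F j = F' j" for j
      using F fun_cong[OF eq, of j] by (cases "j = Suc m") (auto simp: partial_flags_def extensional_def)
    moreover have "J = J'" using fun_cong[OF eq, of "Suc m"] by simp
    ultimately show "F = F' \<and> J = J'" by blast
  qed
  have sub: "?f ` ?S \<subseteq> partial_flags (Suc m)"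
    by (auto simp: partial_flags_def between_def extensional_def le_Suc_eq less_Suc_eq) blast
  have "p ^ (\<Sum>j<Suc m. n - Suc j) = p ^ (\<Sum>j<m. n - Suc j) * p ^ (n - Suc m)"
    by (simp add: power_add)
  also have "\<dots> \<le> card (partial_flags m) * p ^ (n - Suc m)"
    using Suc by (intro mult_right_mono) auto
  also have "\<dots> = (\<Sum>F\<in>partial_flags m. p ^ (n - Suc m))" by simp
  also have "\<dots> \<le> (\<Sum>F\<in>partial_flags m. card (between (F m) (carrier G)))"
    using Suc.prems by (intro sum_mono card_extensions_ge) (auto simp: partial_flags_def)
  also have "\<dots> = card ?S"
    using finite_partial_flags finite_between by (simp add: card_SigmaI)
  also have "\<dots> = card (?f ` ?S)" using inj by (simp add: card_image)
  also have "\<dots> \<le> card (partial_flags (Suc m))"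
    using sub finite_partial_flags by (rule card_mono[rotated])
  finally show ?case .
qed

text \<open>Squared because the exponents in \<open>card_partial_flags_ge\<close> sum to
  \<open>n * (n - 1) / 2\<close>.\<close>

lemma card_flags_ge: "p ^ (n * (n - 1)) \<le> (card {F. flag F})\<^sup>2"
proof -
  have "(\<Sum>j<n. n - Suc j) = (\<Sum>j<n. j)" by (rule sum.nat_diff_reindex)
  moreover have "2 * (\<Sum>j<m. j) = m * (m - 1)" for m :: nat
  proof (induction m)
    case (Suc m)
    then show ?case by (cases m) (auto simp: algebra_simps)
  qed simp
  ultimately have "p ^ (n * (n - 1)) = (p ^ (\<Sum>j<n. n - Suc j))\<^sup>2"
    by (simp flip: power_mult add: mult.commute)
  also have "\<dots> \<le> (card {F. flag F})\<^sup>2"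
    using card_partial_flags_ge[of n] by (intro power_mono) (simp_all add: flag_iff_partial)
  finally show ?thesis .
qed

section \<open>Vertices, neighbours and degrees of the flag graph\<close>

definition braid :: "(nat \<Rightarrow> 'a set) \<Rightarrow> (nat \<Rightarrow> 'a set) \<Rightarrow> nat \<Rightarrow> 'a set" where
  "braid x y j = (if even j then x j else y j)"

text \<open>A pair (even part, odd part) is encoded as one function. The parts come from unrelated
  flags, so consecutive members need not be nested.\<close>

definition flag_verts :: "(nat \<Rightarrow> 'a set) set" where
  "flag_verts = {braid A A' |A A'. flag A \<and> flag A'}"

text \<open>\<open>flag (braid x y)\<close> expresses incidence of the even part of \<open>x\<close>
  with the odd part of \<open>y\<close>. A vertex that is itself a flag carries a loop.\<close>

definition flag_adj :: "((nat \<Rightarrow> 'a set) \<times> (nat \<Rightarrow> 'a set)) set" where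
  "flag_adj = {(x, y). x \<in> flag_verts \<and> y \<in> flag_verts \<and> flag (braid x y) \<and> flag (braid y x)}"

lemma braid_in_flag_verts: "flag A \<Longrightarrow> flag A' \<Longrightarrow> braid A A' \<in> flag_verts"
  by (auto simp: flag_verts_def)

text \<open>Contains the neighbours of \<open>x\<close>, restricted to the inner positions: in the
  braid of \<open>x\<close> with a neighbour, the member at \<open>j\<close> taken from one lies
  between two members of the other. No further inclusions are demanded, so the choices are
  independent.\<close>

definition completions :: "(nat \<Rightarrow> 'a set) \<Rightarrow> (nat \<Rightarrow> 'a set) set" where
  "completions x = (\<Pi>\<^sub>E j\<in>{1..<n}. between (x (j - 1)) (x (Suc j)))"

lemma finite_flags: "finite {F. flag F}"
  using finite_partial_flags[of n] by (simp add: flag_iff_partial)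

lemma finite_flag_verts: "finite flag_verts"
proof -
  have "flag_verts = (\<lambda>(A, A'). braid A A') ` ({F. flag F} \<times> {F. flag F})"
    by (auto simp: flag_verts_def)
  then show ?thesis using finite_flags by simp
qed

lemma finite_completions: "finite (completions x)"
  unfolding completions_def using finite_between by (intro finite_PiE) auto

lemma flag_between:
  assumes F: "flag F" and j: "0 < j" "j < n"
  shows "F j \<in> between (F (j - 1)) (F (Suc j))"
  using flagD[OF F, of "j - 1"] flagD[OF F, of j] j
  by (cases j) (auto simp: between_def)

text \<open>\<open>j - 1\<close> and \<open>Suc j\<close> have the same parity, so both members of
  \<open>x\<close> come from one flag and \<open>card_between_le\<close> applies at each of the
  \<open>n - 1\<close> positions.\<close>

lemma card_completions_le:
  assumes "x \<in> flag_verts"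
  shows "card (completions x) \<le> (p + 1) ^ (n - 1)"
proof -
  obtain A A' where A: "flag A" "flag A'" and x: "x = braid A A'"
    using assms by (auto simp: flag_verts_def)
  have "card (between (x (j - 1)) (x (Suc j))) \<le> p + 1" if j: "j \<in> {1..<n}" for j
  proof -
    obtain F where F: "flag F" "x (j - 1) = F (j - 1)" "x (Suc j) = F (Suc j)"
      using A j by (cases "even j") (auto simp: x braid_def)
    obtain i where i: "j = Suc i" using j by (cases j) auto
    show ?thesis
      unfolding F using flagD[OF F(1), of i] flagD[OF F(1), of "Suc i"] flagD[OF F(1), of "Suc j"] j
      by (intro card_between_le) (auto simp: i)
  qed
  then have "(\<Prod>j\<in>{1..<n}. card (between (x (j - 1)) (x (Suc j)))) \<le> (\<Prod>j\<in>{1..<n}. p + 1)"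
    by (intro prod_mono) simp
  then have "card (completions x) \<le> (\<Prod>j\<in>{1..<n}. p + 1)"
    unfolding completions_def by (subst card_PiE) simp_all
  then show ?thesis by simp
qed

lemma flag_outside: "flag F \<Longrightarrow> j \<notin> {..n} \<Longrightarrow> F j = undefined"
  using extensional_arb[of F "{..n}" j] unfolding flag_def by blast

lemma flag_eqI:
  assumes "flag F" "flag F'" "\<And>j. 0 < j \<Longrightarrow> j < n \<Longrightarrow> F j = F' j"
  shows "F = F'"
proof
  fix j
  consider "j = 0" | "j = n" | "0 < j" "j < n" | "j \<notin> {..n}" by force
  then show "F j = F' j"
    using assms flag_top[OF assms(1)] flag_top[OF assms(2)] flag_bot[OF assms(1)] flag_bot[OF assms(2)]
      flag_outside[OF assms(1), of j] flag_outside[OF assms(2), of j]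
    by cases auto
qed

lemma flag_verts_eqI:
  assumes "x \<in> flag_verts" "y \<in> flag_verts" "\<And>j. 0 < j \<Longrightarrow> j < n \<Longrightarrow> x j = y j"
  shows "x = y"
proof
  obtain A A' B B' where F: "flag A" "flag A'" "flag B" "flag B'" "x = braid A A'" "y = braid B B'"
    using assms by (auto simp: flag_verts_def)
  fix j
  consider "j = 0" | "j = n" | "0 < j" "j < n" | "j \<notin> {..n}" by force
  then show "x j = y j"
  proof cases
    case 1 then show ?thesis using F by (simp add: braid_def flag_bot)
  next
    case 2 then show ?thesis using F by (simp add: braid_def flag_top)
  next
    case 3 then show ?thesis using assms by blast
  next
    case 4 then show ?thesis
      using flag_outside[OF F(1) 4] flag_outside[OF F(2) 4] flag_outside[OF F(3) 4]
        flag_outside[OF F(4) 4] by (simp add: F(5,6) braid_def)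
  qed
qed

text \<open>Exchanging odd parts turns a pair of flags into the vertex \<open>braid A A'\<close> and
  its completion \<open>braid A' A\<close>, from which the pair can be recovered. So there are at
  most as many pairs of flags as vertices with a completion.\<close>

lemma card_flag_verts_ge: "p ^ (n * (n - 1)) \<le> card flag_verts * (p + 1) ^ (n - 1)"
proof -
  let ?F = "{F. flag F}"
  let ?f = "\<lambda>(A, A'). (braid A A', restrict (braid A' A) {1..<n})"
  have inj: "inj_on ?f (?F \<times> ?F)"
  proof (rule inj_onI, clarify)
    fix A A' B B'
    assume F: "flag A" "flag A'" "flag B" "flag B'"
      and eq: "braid A A' = braid B B'" "restrict (braid A' A) {1..<n} = restrict (braid B' B) {1..<n}"
    have "A j = B j \<and> A' j = B' j" if "0 < j" "j < n" for j
      using fun_cong[OF eq(1), of j] fun_cong[OF eq(2), of j] that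
      by (cases "even j") (simp_all add: braid_def)
    then show "A = B \<and> A' = B'" using flag_eqI[OF F(1,3)] flag_eqI[OF F(2,4)] by simp
  qed
  have sub: "?f ` (?F \<times> ?F) \<subseteq> Sigma flag_verts completions"
  proof clarify
    fix A A' assume A: "flag A" "flag A'"
    have "restrict (braid A' A) {1..<n} \<in> completions (braid A A')"
      using flag_between A by (auto simp: completions_def braid_def)
    then show "braid A A' \<in> flag_verts \<and> restrict (braid A' A) {1..<n} \<in> completions (braid A A')"
      using A by (auto simp: flag_verts_def)
  qed
  have "p ^ (n * (n - 1)) \<le> card (?F \<times> ?F)"
    using card_flags_ge by (simp add: card_cartesian_product power2_eq_square)
  also have "\<dots> = card (?f ` (?F \<times> ?F))" using inj by (simp add: card_image)
  also have "\<dots> \<le> card (Sigma flag_verts completions)"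
    using sub finite_flag_verts finite_completions by (intro card_mono) auto
  also have "\<dots> = (\<Sum>x\<in>flag_verts. card (completions x))"
    using finite_flag_verts finite_completions by (simp add: card_SigmaI)
  also have "\<dots> \<le> (\<Sum>x\<in>flag_verts. (p + 1) ^ (n - 1))"
    by (intro sum_mono card_completions_le)
  finally show ?thesis by simp
qed

text \<open>The inner members of a neighbour form a completion of \<open>x\<close> and determine the
  neighbour.\<close>

lemma flag_adj_degree:
  assumes x: "x \<in> flag_verts"
  shows "card {y. (x, y) \<in> flag_adj} \<le> (p + 1) ^ (n - 1)"
proof -
  let ?N = "{y. (x, y) \<in> flag_adj}"
  have "restrict y {1..<n} \<in> completions x" if "y \<in> ?N" for y
    unfolding completions_def
  proof (intro PiE_I)
    fix j assume "j \<in> {1..<n}"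
    then have j: "0 < j" "j < n" by auto
    obtain F where "flag F" "y j = F j" "x (j - 1) = F (j - 1)" "x (Suc j) = F (Suc j)"
    proof (cases "even j")
      case True
      then show ?thesis
        using that[of "braid y x"] \<open>y \<in> ?N\<close> j by (auto simp: flag_adj_def braid_def)
    next
      case False
      then show ?thesis
        using that[of "braid x y"] \<open>y \<in> ?N\<close> j by (auto simp: flag_adj_def braid_def)
    qed
    then show "restrict y {1..<n} j \<in> between (x (j - 1)) (x (Suc j))"
      using flag_between[of F j] j by simp
  qed auto
  then have "(\<lambda>y. restrict y {1..<n}) ` ?N \<subseteq> completions x" by blast
  moreover have "inj_on (\<lambda>y. restrict y {1..<n}) ?N"
  proof (rule inj_onI)
    fix y z assume "y \<in> ?N" "z \<in> ?N" and eq: "restrict y {1..<n} = restrict z {1..<n}"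
    then have "y \<in> flag_verts" "z \<in> flag_verts" by (auto simp: flag_adj_def)
    moreover have "y j = z j" if "0 < j" "j < n" for j
      using fun_cong[OF eq, of j] that by simp
    ultimately show "y = z" by (rule flag_verts_eqI)
  qed
  ultimately have "card ?N \<le> card (completions x)"
    using finite_completions by (metis card_inj_on_le)
  then show ?thesis using card_completions_le[OF x] by simp
qed

text \<open>Two sortings run in parallel with opposite parities. The vertex \<open>z t\<close>
  collects from each the members that the coming round keeps, so braiding it with
  \<open>z (Suc t)\<close> gives \<open>C (Suc t)\<close> and \<open>C' (Suc t)\<close>. What
  \<open>z (n - 1)\<close> shows is kept by the last round, so \<open>n\<close> rounds give a walk
  of only \<open>n - 1\<close> steps.\<close>

lemma flag_adj_walk:
  assumes "x \<in> flag_verts" "y \<in> flag_verts" "n \<ge> 1"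
  shows "(x, y) \<in> flag_adj ^^ (n - 1)"
proof -
  obtain A A' D D' where F: "flag A" "flag A'" "flag D" "flag D'" "x = braid A A'" "y = braid D D'"
    using assms by (auto simp: flag_verts_def)
  \<comment> \<open>The parity of \<open>n\<close> decides which sorting shows the even members at
    time \<open>n - 1\<close>; the targets are assigned accordingly.\<close>
  define E where "E = (if odd n then D else D')"
  define E' where "E' = (if odd n then D' else D)"
  have E: "flag E" "flag E'" using F by (auto simp: E_def E'_def)
  obtain C where C: "C 0 = A" "C n = E" "\<And>t. flag (C t)"
    "\<And>t j. even j \<noteq> (even t = False) \<Longrightarrow> C (Suc t) j = C t j"
    using flag_sort[OF F(1) E(1), of False] by blast
  obtain C' where C': "C' 0 = A'" "C' n = E'" "\<And>t. flag (C' t)"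
    "\<And>t j. even j \<noteq> (even t = True) \<Longrightarrow> C' (Suc t) j = C' t j"
    using flag_sort[OF F(2) E(2), of True] by blast
  have CS: "C (Suc t) j = C t j" if "even j = even t" for t j
    using C(4)[of j t] that by simp
  have CS': "C' (Suc t) j = C' t j" if "even j \<noteq> even t" for t j
    using C'(4)[of j t] that by simp
  define z where "z t j = (if even j = even t then C t j else C' t j)" for t j
  have zV: "z t \<in> flag_verts" for t
  proof -
    have "z t = (if even t then braid (C t) (C' t) else braid (C' t) (C t))"
      by (auto simp: z_def braid_def fun_eq_iff)
    then show ?thesis using C(3) C'(3) by (simp add: braid_in_flag_verts)
  qed
  have "braid (z t) (z (Suc t)) = (if even t then C (Suc t) else C' (Suc t))"
    "braid (z (Suc t)) (z t) = (if even t then C' (Suc t) else C (Suc t))" for t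
    using CS CS' by (auto simp: z_def braid_def fun_eq_iff)
  then have adj: "(z t, z (Suc t)) \<in> flag_adj" for t
    using zV C(3) C'(3) by (simp add: flag_adj_def)
  have "z 0 = x" using C(1) C'(1) F(5) by (auto simp: z_def braid_def fun_eq_iff)
  moreover have "z (n - 1) = y"
  proof
    fix j
    have n: "Suc (n - 1) = n" and par: "even (n - 1) = odd n" using assms(3) by auto
    show "z (n - 1) j = y j"
    proof (cases "even j = odd n")
      case True
      then have "z (n - 1) j = E j" using CS[of j "n - 1"] C(2) par n by (simp add: z_def)
      then show ?thesis using True F(6) by (auto simp: E_def braid_def)
    next
      case False
      then have "z (n - 1) j = E' j" using CS'[of j "n - 1"] C'(2) par n by (simp add: z_def)
      then show ?thesis using False F(6) by (auto simp: E'_def braid_def)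
    qed
  qed
  ultimately show ?thesis
    using adj unfolding relpow_fun_conv by blast
qed

end

lemma elementary_abelian_group_exists:
  assumes "prime p"
  shows "elementary_abelian_group (product_group {..<n} (\<lambda>_. integer_mod_group p)) p n"
proof -
  let ?Z = "integer_mod_group p" and ?G = "product_group {..<n} (\<lambda>_. integer_mod_group p)"
  have p: "p > 0" using assms prime_gt_0_nat by blast
  interpret G: group ?G by (rule product_group) simp
  have carrier: "carrier ?G = {..<n} \<rightarrow>\<^sub>E {0..<int p}"
    using p by (simp add: carrier_integer_mod_group)
  have "comm_group ?G"
    by (rule G.group_comm_groupI) (auto simp: mult_product_group mult_integer_mod_group add.commute)
  moreover have "finite (carrier ?G)" unfolding carrier by (simp add: finite_PiE)
  moreover have "card (carrier ?G) = p ^ n" unfolding carrier by (simp add: card_PiE)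
  moreover have "x [^]\<^bsub>?G\<^esub> p = \<one>\<^bsub>?G\<^esub>" if x: "x \<in> carrier ?G" for x
  proof -
    have "x [^]\<^bsub>?G\<^esub> i = (\<lambda>j\<in>{..<n}. (int i * x j) mod int p)" for i :: nat
      by (induction i) (auto simp: mult_product_group mult_integer_mod_group algebra_simps
          mod_add_left_eq mod_add_right_eq)
    then show ?thesis by simp
  qed
  ultimately show ?thesis
    using assms by (simp add: elementary_abelian_group_def elementary_abelian_group_axioms_def)
qed

section \<open>Graphs of bounded degree and diameter\<close>

text \<open>Loops may occur in \<open>S\<close> but do not count for the degree, and
  \<open>Id\<close> lets a walk pause, so that \<open>k\<close> steps stand for distance at most
  \<open>k\<close>.\<close>

definition walk_graph :: "nat \<Rightarrow> nat \<Rightarrow> 'a set \<Rightarrow> ('a \<times> 'a) set \<Rightarrow> bool" where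
  "walk_graph k r V S \<longleftrightarrow> finite V \<and> S \<subseteq> V \<times> V \<and> sym S \<and>
     (\<forall>u\<in>V. card {v. v \<noteq> u \<and> (u, v) \<in> S} \<le> r) \<and> V \<times> V \<subseteq> (S \<union> Id) ^^ k"

lemma relpow_reflcl_bounded: "(u, v) \<in> (S \<union> Id) ^^ k \<Longrightarrow> \<exists>l\<le>k. (u, v) \<in> S ^^ l"
proof (induction k arbitrary: v)
  case (Suc k)
  then obtain w where w: "(u, w) \<in> (S \<union> Id) ^^ k" "(w, v) \<in> S \<union> Id" by auto
  then obtain l where "l \<le> k" "(u, w) \<in> S ^^ l" using Suc.IH by blast
  then show ?case
    using w(2) le_SucI[of l k] relpow_Suc_I[where R = S and n = l] by (metis Suc_le_mono UnE pair_in_Id_conv)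
qed auto

section \<open>Distance, diameter and degree in terms of the arc relation\<close>

lemma (in pair_wf_digraph) relpow_iff_awalk:
  assumes "u \<in> pverts G"
  shows "(u, v) \<in> parcs G ^^ l \<longleftrightarrow> (\<exists>p. awalk u p v \<and> length p = l)"
  using assms
proof (induction l arbitrary: u)
  case 0
  then show ?case by (auto simp: awalk_Nil_iff)
next
  case (Suc l)
  show ?case
  proof
    assume "(u, v) \<in> parcs G ^^ Suc l"
    then obtain w where w: "(u, w) \<in> parcs G" "(w, v) \<in> parcs G ^^ l" by (rule relpow_Suc_E2)
    then obtain p where "awalk w p v" "length p = l" using Suc.IH in_arcsD2 by blast
    then have "awalk u ((u, w) # p) v \<and> length ((u, w) # p) = Suc l"
      using w by (simp add: awalk_Cons_iff)
    then show "\<exists>p. awalk u p v \<and> length p = Suc l" by blast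
  next
    assume "\<exists>p. awalk u p v \<and> length p = Suc l"
    then obtain e p where e: "awalk u (e # p) v" "length p = l" by (auto simp: length_Suc_conv)
    then have "e \<in> parcs G" "fst e = u" "awalk (snd e) p v" by (auto simp: awalk_Cons_iff)
    moreover from this have "(snd e, v) \<in> parcs G ^^ l" using Suc.IH arc_snd_in_verts e by blast
    ultimately show "(u, v) \<in> parcs G ^^ Suc l" by (metis prod.collapse relpow_Suc_I2)
  qed
qed

lemma (in pair_wf_digraph) graph_dist_le_iff:
  assumes "u \<in> pverts G"
  shows "graph_dist G u v \<le> ereal (real k) \<longleftrightarrow> (\<exists>l\<le>k. (u, v) \<in> parcs G ^^ l)"
proof -
  have cost: "awalk_cost (\<lambda>_. 1) p = real (length p)" for p
    by (induction p) simp_all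
  have "graph_dist G u v = (INF p\<in>{p. awalk u p v}. ereal (real (length p)))"
    by (simp add: graph_dist_def \<mu>_def cost)
  then have "graph_dist G u v \<le> ereal (real k) \<longleftrightarrow> (\<exists>p. awalk u p v \<and> length p \<le> k)"
  proof -
    let ?I = "INF p\<in>{p. awalk u p v}. ereal (real (length p))"
    have "\<exists>p. awalk u p v \<and> length p \<le> k" if "?I \<le> ereal (real k)"
    proof -
      \<comment> \<open>The infimum is not known to be attained; a strict comparison with
        \<open>Suc k\<close> produces a walk, whose length is then at most \<open>k\<close>.\<close>
      have "?I < ereal (real (Suc k))" using that by (rule le_less_trans) simp
      then show ?thesis by (auto simp: INF_less_iff less_Suc_eq_le)
    qed
    moreover have "?I \<le> ereal (real k)" if "awalk u p v" "length p \<le> k" for p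
      using that by (intro INF_lower2[of p]) auto
    ultimately show ?thesis using \<open>graph_dist G u v = ?I\<close> by auto
  qed
  then show ?thesis using relpow_iff_awalk[OF assms] by auto
qed

lemma (in pair_graph) graph_diam_le_iff:
  assumes "pverts G \<noteq> {}"
  shows "graph_diam G \<le> ereal (real k) \<longleftrightarrow>
    (\<forall>u\<in>pverts G. \<forall>v\<in>pverts G. \<exists>l\<le>k. (u, v) \<in> parcs G ^^ l)"
proof -
  let ?D = "{graph_dist G u v | u v. u \<in> pverts G \<and> v \<in> pverts G}"
  have "?D = (\<lambda>(u, v). graph_dist G u v) ` (pverts G \<times> pverts G)" by auto
  then have "finite ?D" "?D \<noteq> {}" using pair_finite_verts assms by auto
  then have "graph_diam G \<le> ereal (real k) \<longleftrightarrow> (\<forall>x\<in>?D. x \<le> ereal (real k))"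
    unfolding graph_diam_def by (rule Max_le_iff)
  then show ?thesis using graph_dist_le_iff by blast
qed

lemma (in pair_graph) max_degree_le_iff:
  assumes "pverts G \<noteq> {}"
  shows "max_degree G \<le> d \<longleftrightarrow> (\<forall>u\<in>pverts G. card (parcs G `` {u}) \<le> d)"
proof -
  have deg: "out_degree (with_proj G) u = card (parcs G `` {u})" for u
  proof -
    have "out_arcs (with_proj G) u = Pair u ` (parcs G `` {u})" by (auto simp: out_arcs_def)
    then show ?thesis by (simp add: out_degree_def card_image inj_on_def)
  qed
  have "{out_degree (with_proj G) v | v. v \<in> pverts G} = (\<lambda>v. card (parcs G `` {v})) ` pverts G"
    by (auto simp: deg)
  then show ?thesis
    unfolding max_degree_def using pair_finite_verts assms by simp
qed

section \<open>The Moore bound and transfer to graphs on natural numbers\<close>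

text \<open>Walks of length \<open>i\<close> from a fixed vertex have at most \<open>d ^ i\<close>
  endpoints. Backtracking is not excluded, as only the leading term \<open>d ^ k\<close> matters for
  the limit.\<close>

lemma (in pair_graph) moore_bound:
  assumes "pverts G \<noteq> {}" "max_degree G \<le> d" "graph_diam G \<le> ereal (real k)"
  shows "card (pverts G) \<le> (\<Sum>i\<le>k. d ^ i)"
proof -
  obtain u where u: "u \<in> pverts G" using assms by blast
  let ?A = "parcs G"
  have fin: "finite (?A `` X)" for X
    by (rule finite_subset[OF _ pair_finite_verts]) (auto dest: in_arcsD2)
  have level: "finite ((?A ^^ i) `` {u}) \<and> (?A ^^ i) `` {u} \<subseteq> pverts G \<and> card ((?A ^^ i) `` {u}) \<le> d ^ i" for i
  proof (induction i)
    case 0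
    then show ?case using u by simp
  next
    case (Suc i)
    have eq: "(?A ^^ Suc i) `` {u} = (\<Union>w\<in>(?A ^^ i) `` {u}. ?A `` {w})" by auto
    have "card ((?A ^^ Suc i) `` {u}) \<le> (\<Sum>w\<in>(?A ^^ i) `` {u}. card (?A `` {w}))"
      unfolding eq using Suc by (intro card_UN_le) auto
    also have "\<dots> \<le> (\<Sum>w\<in>(?A ^^ i) `` {u}. d)"
      using Suc assms(1,2) by (intro sum_mono) (auto simp: max_degree_le_iff)
    also have "\<dots> \<le> d ^ Suc i" using Suc by (simp add: mult.commute)
    finally have "card ((?A ^^ Suc i) `` {u}) \<le> d ^ Suc i" .
    moreover have "finite ((?A ^^ Suc i) `` {u})" using fin by (simp add: relcomp_Image)
    moreover have "(?A ^^ Suc i) `` {u} \<subseteq> pverts G" by (auto dest: in_arcsD2)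
    ultimately show ?case by blast
  qed
  have "pverts G \<subseteq> (\<Union>i\<le>k. (?A ^^ i) `` {u})"
  proof
    fix v assume "v \<in> pverts G"
    then obtain l where "l \<le> k" "(u, v) \<in> ?A ^^ l"
      using assms(3) u graph_diam_le_iff[OF assms(1)] by blast
    then show "v \<in> (\<Union>i\<le>k. (?A ^^ i) `` {u})" by blast
  qed
  then have "card (pverts G) \<le> card (\<Union>i\<le>k. (?A ^^ i) `` {u})"
    using level by (intro card_mono) auto
  also have "\<dots> \<le> (\<Sum>i\<le>k. card ((?A ^^ i) `` {u}))" by (intro card_UN_le) simp
  also have "\<dots> \<le> (\<Sum>i\<le>k. d ^ i)" using level by (intro sum_mono) blast
  finally show ?thesis .
qed

lemma finite_admissible_orders:
  "finite {card (pverts G) | G :: nat pair_pre_digraph.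
     pair_graph G \<and> pverts G \<noteq> {} \<and> max_degree G \<le> d \<and> graph_diam G \<le> ereal (real k)}"
  by (rule finite_subset[of _ "{..\<Sum>i\<le>k. d ^ i}"]) (auto intro: pair_graph.moore_bound)

text \<open>The vertices are numbered to match the type in \<open>degree_diameter_number\<close>.
  Loops are dropped, which alters neither the counted degrees nor
  \<open>S \<union> Id\<close>.\<close>

lemma card_le_degree_diameter_number:
  assumes g: "walk_graph k r V S" and ne: "V \<noteq> {}" and "r \<le> d"
  shows "card V \<le> degree_diameter_number k d"
proof -
  have fin: "finite V" and SV: "S \<subseteq> V \<times> V" and "sym S"
    and deg: "\<And>u. u \<in> V \<Longrightarrow> card {v. v \<noteq> u \<and> (u, v) \<in> S} \<le> r"
    and walk: "V \<times> V \<subseteq> (S \<union> Id) ^^ k"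
    using g by (auto simp: walk_graph_def)
  obtain f where f: "bij_betw f V {0..<card V}" using ex_bij_betw_finite_nat[OF fin] by blast
  then have inj: "inj_on f V" and im: "f ` V = {0..<card V}" by (auto simp: bij_betw_def)
  define G where "G = \<lparr>pverts = f ` V, parcs = map_prod f f ` (S - Id)\<rparr>"
  have arcs: "parcs G = {(f u, f v) | u v. (u, v) \<in> S \<and> u \<noteq> v}" by (force simp: G_def)
  have finS: "finite S" using SV fin finite_subset by blast
  have G: "pair_graph G"
  proof
    show "fst e \<in> pverts G" "snd e \<in> pverts G" if "e \<in> parcs G" for e
      using that SV by (auto simp: arcs) (auto simp: G_def)
    show "finite (pverts G)" "finite (parcs G)" using fin finS by (auto simp: G_def)
    show "fst e \<noteq> snd e" if "e \<in> parcs G" for e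
      using that SV inj by (auto simp: arcs inj_on_eq_iff)
    have "sym (parcs G)" using \<open>sym S\<close> unfolding arcs sym_def by blast
    then show "symmetric (with_proj G)" by (simp add: symmetric_def)
  qed
  interpret pair_graph G by (rule G)
  have ne': "pverts G \<noteq> {}" using ne by (simp add: G_def)
  have "max_degree G \<le> d"
    unfolding max_degree_le_iff[OF ne']
  proof
    fix x assume "x \<in> pverts G"
    then obtain u where u: "u \<in> V" "x = f u" by (auto simp: G_def)
    have "parcs G `` {x} \<subseteq> f ` {v. v \<noteq> u \<and> (u, v) \<in> S}"
      using u SV inj by (auto simp: arcs inj_on_eq_iff)
    moreover have fin': "finite {v. v \<noteq> u \<and> (u, v) \<in> S}"
      by (rule finite_subset[OF _ fin]) (use SV in auto)
    ultimately have "card (parcs G `` {x}) \<le> card {v. v \<noteq> u \<and> (u, v) \<in> S}"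
      using surj_card_le by blast
    then show "card (parcs G `` {x}) \<le> d" using deg[OF u(1)] \<open>r \<le> d\<close> by simp
  qed
  moreover have "graph_diam G \<le> ereal (real k)"
    unfolding graph_diam_le_iff[OF ne']
  proof (intro ballI)
    fix x y assume "x \<in> pverts G" "y \<in> pverts G"
    then obtain u v where uv: "u \<in> V" "v \<in> V" "x = f u" "y = f v" by (auto simp: G_def)
    have "(S - Id) \<union> Id = S \<union> Id" by blast
    moreover have "(u, v) \<in> (S \<union> Id) ^^ k" using walk uv(1,2) by blast
    ultimately have "(u, v) \<in> ((S - Id) \<union> Id) ^^ k" by (simp only:)
    then obtain l where l: "l \<le> k" "(u, v) \<in> (S - Id) ^^ l"
      using relpow_reflcl_bounded[where S = "S - Id"] by blast
    from l(2) have "(f u, f v) \<in> parcs G ^^ l"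
    proof (induction l arbitrary: v)
      case (Suc l)
      then obtain w where "(u, w) \<in> (S - Id) ^^ l" "(w, v) \<in> S - Id" by auto
      moreover from this have "(f w, f v) \<in> parcs G" unfolding G_def by force
      ultimately show ?case using Suc.IH by (intro relpow_Suc_I)
    qed simp
    then show "\<exists>l\<le>k. (x, y) \<in> parcs G ^^ l" using l uv by blast
  qed
  ultimately have "card (pverts G) \<le> degree_diameter_number k d"
    unfolding degree_diameter_number_def
    using G ne' by (intro Max_ge finite_admissible_orders) blast
  then show ?thesis using im by (simp add: G_def)
qed

lemma degree_diameter_number_le: "degree_diameter_number k d \<le> (\<Sum>i\<le>k. d ^ i)"
proof -
  let ?X = "{card (pverts G) | G :: nat pair_pre_digraph.
     pair_graph G \<and> pverts G \<noteq> {} \<and> max_degree G \<le> d \<and> graph_diam G \<le> ereal (real k)}"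
  \<comment> \<open>\<open>Max\<close> needs a nonempty set; the one-vertex graph supplies a
    member.\<close>
  have "pair_graph \<lparr>pverts = {0 :: nat}, parcs = {}\<rparr>"
    by unfold_locales (auto simp: symmetric_def sym_def)
  moreover have "max_degree \<lparr>pverts = {0 :: nat}, parcs = {}\<rparr> \<le> d"
    by (subst pair_graph.max_degree_le_iff[OF calculation]) auto
  moreover have "graph_diam \<lparr>pverts = {0 :: nat}, parcs = {}\<rparr> \<le> ereal (real k)"
    by (subst pair_graph.graph_diam_le_iff[OF calculation(1)]) (auto intro!: exI[of _ 0])
  ultimately have "?X \<noteq> {}" by fastforce
  then show ?thesis
    unfolding degree_diameter_number_def
    using finite_admissible_orders by (subst Max_le_iff) (auto intro: pair_graph.moore_bound)
qed

section \<open>Blow-ups\<close>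

text \<open>Subtracting \<open>e k\<close> times row \<open>j\<close> from row \<open>Suc j\<close>
  removes the unknown \<open>t k\<close> and leaves a smaller system in
  \<open>s i = t i * (e i - e k)\<close>. As \<open>q\<close> may be composite, the differences are
  required to be units.\<close>

lemma vandermonde_cong_solvable:
  fixes e D :: "nat \<Rightarrow> int" and q :: int
  assumes "\<And>i j. i < j \<Longrightarrow> j < k \<Longrightarrow> coprime (e i - e j) q"
  shows "\<exists>t. \<forall>j<k. [(\<Sum>i<k. t i * e i ^ j) = D j] (mod q)"
  using assms
proof (induction k arbitrary: D)
  case (Suc k)
  obtain s where s: "\<And>j. j < k \<Longrightarrow> [(\<Sum>i<k. s i * e i ^ j) = D (Suc j) - e k * D j] (mod q)"
    using Suc.IH[of "\<lambda>j. D (Suc j) - e k * D j"] Suc.prems by auto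
  have "\<forall>i. \<exists>c. i < k \<longrightarrow> [(e i - e k) * c = 1] (mod q)"
    using Suc.prems cong_solve_coprime_int by blast
  then obtain c where c: "\<And>i. i < k \<Longrightarrow> [(e i - e k) * c i = 1] (mod q)" by metis
  \<comment> \<open>\<open>c i\<close> inverts \<open>e i - e k\<close>, and the last unknown is set
    so that row 0 holds; the other rows follow by induction on \<open>j\<close>.\<close>
  define t where "t i = (if i < k then s i * c i else D 0 - (\<Sum>i<k. s i * c i))" for i
  have "[(\<Sum>i<Suc k. t i * e i ^ j) = D j] (mod q)" if "j < Suc k" for j
    using that
  proof (induction j)
    case 0
    then show ?case by (simp add: t_def)
  next
    case (Suc j)
    have "(\<Sum>i<Suc k. t i * e i ^ Suc j) - e k * (\<Sum>i<Suc k. t i * e i ^ j)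
        = (\<Sum>i<Suc k. t i * (e i - e k) * e i ^ j)"
      by (simp only: sum_distrib_left sum_subtractf[symmetric]) (simp add: algebra_simps)
    then have "(\<Sum>i<Suc k. t i * e i ^ Suc j)
        = e k * (\<Sum>i<Suc k. t i * e i ^ j) + (\<Sum>i<k. t i * (e i - e k) * e i ^ j)"
      by simp
    also have "[\<dots> = e k * D j + (D (Suc j) - e k * D j)] (mod q)"
    proof (rule cong_add)
      show "[e k * (\<Sum>i<Suc k. t i * e i ^ j) = e k * D j] (mod q)"
        using Suc by (intro cong_mult) auto
      have "[(\<Sum>i<k. t i * (e i - e k) * e i ^ j) = (\<Sum>i<k. s i * e i ^ j)] (mod q)"
      proof (rule cong_sum)
        fix i assume "i \<in> {..<k}"
        then have "[s i * e i ^ j * ((e i - e k) * c i) = s i * e i ^ j * 1] (mod q)"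
          by (intro cong_mult c) auto
        then show "[t i * (e i - e k) * e i ^ j = s i * e i ^ j] (mod q)"
          using \<open>i \<in> {..<k}\<close> by (simp add: t_def mult_ac)
      qed
      then show "[(\<Sum>i<k. t i * (e i - e k) * e i ^ j) = D (Suc j) - e k * D j] (mod q)"
        using s[of j] Suc.prems cong_trans by auto
    qed
    finally show ?case by simp
  qed
  then show ?case by blast
qed simp

text \<open>A shortest walk repeats no vertex, as the part between two visits could be cut
  out.\<close>

lemma relpow_inj_path:
  assumes "(u, v) \<in> S ^^ m"
  obtains l f where "l \<le> m" "f 0 = u" "f l = v" "\<And>i. i < l \<Longrightarrow> (f i, f (Suc i)) \<in> S" "inj_on f {..l}"
proof -
  define l where "l = (LEAST l. (u, v) \<in> S ^^ l)"
  have l: "(u, v) \<in> S ^^ l" "l \<le> m" and min: "\<And>i. (u, v) \<in> S ^^ i \<Longrightarrow> l \<le> i"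
    using assms LeastI Least_le unfolding l_def by metis+
  obtain f where f: "f 0 = u" "f l = v" "\<And>i. i < l \<Longrightarrow> (f i, f (Suc i)) \<in> S"
    using l(1) unfolding relpow_fun_conv by blast
  have seg: "(f a, f (a + b)) \<in> S ^^ b" if "a + b \<le> l" for a b
    using that by (induction b) (auto intro!: relpow_Suc_I f(3))
  have "f i \<noteq> f j" if "i < j" "j \<le> l" for i j
  proof
    assume eq: "f i = f j"
    have "(u, f i) \<in> S ^^ i" using seg[of 0 i] that f(1) by simp
    moreover have "(f i, v) \<in> S ^^ (l - j)" using seg[of j "l - j"] that f(2) eq by simp
    ultimately have "(u, v) \<in> S ^^ (i + (l - j))" by (auto simp: relpow_add)
    then have "l \<le> i + (l - j)" by (rule min)
    then show False using that by simp
  qed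
  then have "inj_on f {..l}" by (intro linorder_inj_onI) auto
  then show ?thesis using that l f by blast
qed

text \<open>Along an edge with label \<open>e\<close> the new coordinate in \<open>(\<int>/q)\<^sup>k\<close> moves by multiples of the
  direction \<open>(1, e, \<dots>, e\<^sup>k\<^sup>-\<^sup>1)\<close>.  The \<open>k\<close> loops added at each
  vertex pad a shorter path to one with exactly \<open>k\<close> different labels, and \<open>k\<close> directions with
  different labels span \<open>(\<int>/q)\<^sup>k\<close>.\<close>

lemma walk_graph_blow_up:
  fixes V :: "'a set"
  assumes g: "walk_graph k r V S"
  obtains M where "\<And>Q. [Q = 1] (mod fact M) \<Longrightarrow> Q > 0 \<Longrightarrow>
    \<exists>(V' :: ('a \<times> (nat \<Rightarrow> int)) set) S'. walk_graph k ((r + k) * Q) V' S' \<and> card V' = card V * Q ^ k"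
proof -
  have fin: "finite V" and SV: "S \<subseteq> V \<times> V" and "sym S"
    and deg: "\<And>u. u \<in> V \<Longrightarrow> card {v. v \<noteq> u \<and> (u, v) \<in> S} \<le> r"
    and walk: "V \<times> V \<subseteq> (S \<union> Id) ^^ k"
    using g by (auto simp: walk_graph_def)
  \<comment> \<open>An edge gets the label \<open>k + code {u, v}\<close>: it is independent of
    direction and differs from the loop labels \<open>0, ..., k - 1\<close>. All labels are below
    \<open>M\<close>.\<close>
  obtain code m where inj: "inj_on code (Pow V)" and im: "code ` Pow V = {i::nat. i < m}"
    using finite_imp_inj_to_nat_seg[of "Pow V"] fin by auto
  define M where "M = k + m"
  have "\<exists>(V' :: ('a \<times> (nat \<Rightarrow> int)) set) S'. walk_graph k ((r + k) * Q) V' S' \<and> card V' = card V * Q ^ k"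
    if Q: "[Q = 1] (mod fact M)" "Q > 0" for Q :: nat
  proof -
    define q where "q = int Q"
    have q: "q > 0" using Q by (simp add: q_def)
    \<comment> \<open>A nonzero difference of labels divides \<open>fact M\<close>, to which
      \<open>Q\<close> is coprime by the congruence; so such differences are units modulo
      \<open>q\<close>.\<close>
    have cop: "coprime d q" if "d \<noteq> 0" "\<bar>d\<bar> < int M" for d :: int
    proof -
      have "nat \<bar>d\<bar> dvd fact M" using that by (intro dvd_fact) auto
      moreover have "coprime Q (fact M)"
        using Q(1) by (metis cong_imp_coprime cong_sym coprime_1_left)
      ultimately have "coprime (nat \<bar>d\<bar>) Q" by (metis coprime_commute coprime_divisors dvd_refl)
      then have "coprime \<bar>d\<bar> q"
        unfolding q_def by (metis abs_ge_zero coprime_int_iff nat_0_le)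
      then show ?thesis by simp
    qed
    define X where "X = ({..<k} \<rightarrow>\<^sub>E {0..<q})"
    define shift where "shift x t e = (\<lambda>j\<in>{..<k}. (x j + t * int e ^ j) mod q)"
      for x :: "nat \<Rightarrow> int" and t :: int and e :: nat
    define lab where "lab u v e \<longleftrightarrow> (u = v \<and> e < k) \<or> (u \<noteq> v \<and> (u, v) \<in> S \<and> e = k + code {u, v})"
      for u v e
    define V' where "V' = V \<times> X"
    define S' where "S' = {((u, x), (v, shift x t e)) | u v x t e. u \<in> V \<and> v \<in> V \<and> x \<in> X \<and> lab u v e}"
    have shiftX: "shift x t e \<in> X" for x t e using q by (auto simp: shift_def X_def)
    have shift_back: "shift (shift x t e) (- t) e = x" if "x \<in> X" for x t e
    proof
      fix j show "shift (shift x t e) (- t) e j = x j"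
        using that by (cases "j < k") (auto simp: shift_def X_def mod_diff_left_eq PiE_iff extensional_def)
    qed
    have shift_mod: "shift x (t mod q) e = shift x t e" for x t e
      unfolding shift_def by (intro restrict_ext) (metis mod_add_right_eq mod_mult_left_eq)
    have finX: "finite X" unfolding X_def by (intro finite_PiE) auto
    have cardX: "card X = Q ^ k" unfolding X_def by (simp add: card_PiE q_def)
    have "walk_graph k ((r + k) * Q) V' S'"
      unfolding walk_graph_def
    proof (intro conjI ballI)
      show "finite V'" using fin finX by (simp add: V'_def)
      show "S' \<subseteq> V' \<times> V'" using shiftX by (auto simp: S'_def V'_def)
      show "sym S'"
      proof (rule symI)
        fix a b assume "(a, b) \<in> S'"
        then obtain u v x t e where *: "a = (u, x)" "b = (v, shift x t e)" "u \<in> V" "v \<in> V" "x \<in> X" "lab u v e"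
          by (auto simp: S'_def)
        have "lab v u e" using *(6) \<open>sym S\<close> by (auto simp: lab_def insert_commute dest: symD)
        then have "(b, (u, shift (shift x t e) (- t) e)) \<in> S'"
          using * shiftX unfolding S'_def by blast
        then show "(b, a) \<in> S'" using shift_back * by simp
      qed
      fix a assume "a \<in> V'"
      then obtain u x where a: "a = (u, x)" "u \<in> V" "x \<in> X" by (auto simp: V'_def)
      let ?N = "{v. v \<noteq> u \<and> (u, v) \<in> S}"
      let ?E = "(\<lambda>(v, t). (v, shift x t (k + code {u, v}))) ` (?N \<times> {0..<q})"
      let ?L = "(\<lambda>(e, t). (u, shift x t e)) ` ({..<k} \<times> {0..<q})"
      have finN: "finite ?N" by (rule finite_subset[OF _ fin]) (use SV in auto)
      \<comment> \<open>By \<open>shift_mod\<close> only \<open>t\<close> modulo \<open>q\<close>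
        matters, so each of at most \<open>r\<close> edges and each of the \<open>k\<close> loops
        gives at most \<open>Q\<close> neighbours.\<close>
      have "{b. b \<noteq> a \<and> (a, b) \<in> S'} \<subseteq> ?E \<union> ?L"
      proof
        fix b assume "b \<in> {b. b \<noteq> a \<and> (a, b) \<in> S'}"
        then obtain v t e where b: "b = (v, shift x t e)" "lab u v e" by (auto simp: S'_def a)
        have t: "t mod q \<in> {0..<q}" using q by simp
        from b(2) show "b \<in> ?E \<union> ?L"
          unfolding lab_def
        proof (elim disjE conjE)
          assume "u = v" "e < k"
          then have "b \<in> ?L" using b t shift_mod by (intro image_eqI[of _ _ "(e, t mod q)"]) auto
          then show ?thesis by blast
        next
          assume "u \<noteq> v" "(u, v) \<in> S" "e = k + code {u, v}"
          then have "b \<in> ?E" using b t shift_mod by (intro image_eqI[of _ _ "(v, t mod q)"]) auto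
          then show ?thesis by blast
        qed
      qed
      then have "card {b. b \<noteq> a \<and> (a, b) \<in> S'} \<le> card (?E \<union> ?L)"
        using finN by (intro card_mono) auto
      also have "\<dots> \<le> card ?E + card ?L" by (rule card_Un_le)
      also have "card ?E \<le> card (?N \<times> {0..<q})" using finN by (intro card_image_le) auto
      also have "card ?L \<le> card ({..<k} \<times> {0..<q})" by (intro card_image_le) auto
      also have "card (?N \<times> {0..<q}) + card ({..<k} \<times> {0..<q}) \<le> (r + k) * Q"
        using deg[OF a(2)] by (simp add: card_cartesian_product q_def add_mult_distrib)
      finally show "card {b. b \<noteq> a \<and> (a, b) \<in> S'} \<le> (r + k) * Q" by simp
    next
      show "V' \<times> V' \<subseteq> (S' \<union> Id) ^^ k"
      proof clarify
        fix u x v y assume "(u, x) \<in> V'" "(v, y) \<in> V'"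
        then have uv: "u \<in> V" "v \<in> V" "x \<in> X" "y \<in> X" by (auto simp: V'_def)
        then have uvk: "(u, v) \<in> (S \<union> Id) ^^ k" using walk by blast
        obtain l0 where l0: "l0 \<le> k" "(u, v) \<in> S ^^ l0" using relpow_reflcl_bounded[OF uvk] by auto
        obtain l f where l: "l \<le> l0" and f: "f 0 = u" "f l = v"
          "\<And>i. i < l \<Longrightarrow> (f i, f (Suc i)) \<in> S" "inj_on f {..l}"
          using relpow_inj_path[OF l0(2)] by metis
        have lk: "l \<le> k" using l l0 by simp
        have fV: "f i \<in> V" if "i \<le> l" for i
        proof (cases i)
          case (Suc i')
          then have "(f i', f i) \<in> S" using f(3)[of i'] that by simp
          then show ?thesis using SV by blast
        qed (simp add: f(1) uv(1))
        \<comment> \<open>The first \<open>l\<close> steps follow the path, whose edges are distinct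
          because no vertex repeats; afterwards the walk stays at \<open>v\<close> and uses loop
          number \<open>i\<close> at time \<open>i\<close>.\<close>
        define e where "e i = (if i < l then k + code {f i, f (Suc i)} else i)" for i
        have e_less: "e i < M" if "i < k" for i
        proof -
          have "code {f i, f (Suc i)} < m" if "i < l"
            using im fV[of i] fV[of "Suc i"] that by auto
          then show ?thesis using \<open>i < k\<close> by (auto simp: e_def M_def)
        qed
        have e_inj: "e i \<noteq> e j" if "i < j" "j < k" for i j
        proof
          assume eq: "e i = e j"
          show False
          proof (cases "j < l")
            case True
            then have "code {f i, f (Suc i)} = code {f j, f (Suc j)}"
              using eq \<open>i < j\<close> by (simp add: e_def)
            then have "{f i, f (Suc i)} = {f j, f (Suc j)}"
              using fV True \<open>i < j\<close> by (intro inj_onD[OF inj]) auto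
            then have "f i = f j \<or> f i = f (Suc j)" by blast
            then show False using f(4) True \<open>i < j\<close> by (auto dest: inj_onD)
          next
            case False
            then show False using eq that by (auto simp: e_def split: if_splits)
          qed
        qed
        have "coprime (int (e i) - int (e j)) q" if "i < j" "j < k" for i j
          using e_inj[OF that] e_less[of i] e_less[of j] that by (intro cop) auto
        then obtain t where t: "\<And>j. j < k \<Longrightarrow> [(\<Sum>i<k. t i * int (e i) ^ j) = y j - x j] (mod q)"
          using vandermonde_cong_solvable[of k "\<lambda>i. int (e i)" q "\<lambda>j. y j - x j"] by auto
        \<comment> \<open>The second component adds up partial sums of the Vandermonde solution;
          \<open>min i l\<close> freezes the first at \<open>v\<close>.\<close>
        define z where "z i = (f (min i l), \<lambda>j\<in>{..<k}. (x j + (\<Sum>i'<i. t i' * int (e i') ^ j)) mod q)" for i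
        have zX: "snd (z i) \<in> X" for i using q by (auto simp: z_def X_def)
        have fst_z: "fst (z i) = f (min i l)" for i by (simp add: z_def)
        have z0: "z 0 = (u, x)"
          using f(1) uv(3) by (auto simp: z_def X_def fun_eq_iff PiE_iff extensional_def)
        have "(x j + (\<Sum>i<k. t i * int (e i) ^ j)) mod q = y j" if "j < k" for j
        proof -
          have "[x j + (\<Sum>i<k. t i * int (e i) ^ j) = x j + (y j - x j)] (mod q)"
            using t[OF that] by (intro cong_add) auto
          moreover have "y j mod q = y j" using uv(4) that by (auto simp: X_def PiE_iff)
          ultimately show ?thesis by (simp add: unique_euclidean_semiring_class.cong_def)
        qed
        then have zk: "z k = (v, y)"
          using f(2) uv(4) lk by (auto simp: z_def X_def fun_eq_iff min_def PiE_iff extensional_def)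
        have step: "(z i, z (Suc i)) \<in> S'" if "i < k" for i
        proof -
          have lb: "lab (f (min i l)) (f (min (Suc i) l)) (e i)"
          proof (cases "i < l")
            case True
            then have "f i \<noteq> f (Suc i)" using f(4) by (auto dest: inj_onD)
            then show ?thesis using True f(3) by (auto simp: lab_def e_def min_def)
          next
            case False
            then show ?thesis using that by (auto simp: lab_def e_def min_def)
          qed
          have "snd (z (Suc i)) = shift (snd (z i)) (t i) (e i)"
            by (auto simp: z_def shift_def fun_eq_iff mod_add_left_eq add.assoc)
          then have "z (Suc i) = (f (min (Suc i) l), shift (snd (z i)) (t i) (e i))"
            by (simp add: prod_eq_iff fst_z)
          moreover have "z i = (f (min i l), snd (z i))" by (simp add: prod_eq_iff fst_z)
          moreover have "f (min i l) \<in> V" "f (min (Suc i) l) \<in> V" using fV by auto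
          ultimately show ?thesis using lb zX unfolding S'_def by blast
        qed
        have "\<forall>i<k. (z i, z (Suc i)) \<in> S' \<union> Id" using step by blast
        then have "\<exists>f. f 0 = (u, x) \<and> f k = (v, y) \<and> (\<forall>i<k. (f i, f (Suc i)) \<in> S' \<union> Id)"
          using z0 zk by (intro exI[of _ z] conjI)
        then show "((u, x), (v, y)) \<in> (S' \<union> Id) ^^ k" by (simp only: relpow_fun_conv)
      qed
    qed
    moreover have "card V' = card V * Q ^ k"
      by (simp add: V'_def card_cartesian_product cardX)
    ultimately show ?thesis by blast
  qed
  then show ?thesis using that[of M] by blast
qed

section \<open>The limit\<close>

text \<open>Dimension \<open>n = k + 1\<close> makes the walk length \<open>n - 1\<close> equal to
  \<open>k\<close>.\<close>

lemma flag_walk_graph: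
  assumes "prime p"
  obtains V :: "(nat \<Rightarrow> (nat \<Rightarrow> int) set) set" and S
  where "walk_graph k ((p + 1) ^ k) V S" "p ^ ((k + 1) * k) \<le> card V * (p + 1) ^ k"
proof -
  interpret elementary_abelian_group "product_group {..<Suc k} (\<lambda>_. integer_mod_group p)" p "Suc k"
    by (rule elementary_abelian_group_exists[OF assms])
  have "{y. y \<noteq> x \<and> (x, y) \<in> flag_adj} \<subseteq> {y. (x, y) \<in> flag_adj}"
    "finite {y. (x, y) \<in> flag_adj}" for x
    by (auto intro: finite_subset[OF _ finite_flag_verts] simp: flag_adj_def)
  then have "card {y. y \<noteq> x \<and> (x, y) \<in> flag_adj} \<le> card {y. (x, y) \<in> flag_adj}" for x
    by (intro card_mono)
  then have "card {y. y \<noteq> x \<and> (x, y) \<in> flag_adj} \<le> (p + 1) ^ k" if "x \<in> flag_verts" for x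
    using flag_adj_degree[OF that] le_trans by fastforce
  moreover have "(x, y) \<in> (flag_adj \<union> Id) ^^ k" if "x \<in> flag_verts" "y \<in> flag_verts" for x y
  proof -
    have "(x, y) \<in> flag_adj ^^ k" using flag_adj_walk[OF that] by simp
    then show ?thesis unfolding relpow_fun_conv by blast
  qed
  ultimately have "walk_graph k ((p + 1) ^ k) flag_verts flag_adj"
    unfolding walk_graph_def using finite_flag_verts
    by (auto simp: flag_adj_def intro: symI)
  then show ?thesis using that card_flag_verts_ge by simp
qed

section \<open>Asymptotic bounds for the ratio\<close>

text \<open>The blow-up needs \<open>(r + k) * Q \<le> d\<close> and \<open>Q\<close> congruent to 1
  modulo a fixed number. Rounding down to such a \<open>Q\<close> costs a bounded amount, which
  vanishes against \<open>d\<close>.\<close>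

lemma degree_diameter_number_ratio_lower:
  assumes g: "walk_graph k r V S" and ne: "V \<noteq> {}" and rk: "r + k > 0" and lt: "c < card V / real (r + k) ^ k"
  shows "\<forall>\<^sub>F d in sequentially. c < degree_diameter_number k d / real d ^ k"
proof -
  define D where "D = r + k"
  have D: "D > 0" using rk by (simp add: D_def)
  obtain M where M: "\<And>Q. [Q = 1] (mod fact M) \<Longrightarrow> Q > 0 \<Longrightarrow>
    \<exists>(V' :: ('a \<times> (nat \<Rightarrow> int)) set) S'. walk_graph k (D * Q) V' S' \<and> card V' = card V * Q ^ k"
    using walk_graph_blow_up[OF g] unfolding D_def by metis
  define C :: nat where "C = fact M"
  have C: "C > 0" by (simp add: C_def)
  have cV: "card V > 0" using g ne by (simp add: walk_graph_def card_gt_0_iff)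
  have lower: "card V * ((real d / D - (C + 2)) / d) ^ k \<le> degree_diameter_number k d / real d ^ k"
    if d: "d \<ge> D * (C + 2)" for d
  proof -
    \<comment> \<open>The largest number congruent to 1 modulo \<open>C\<close> that does not exceed
      \<open>d div D\<close>. It falls short of \<open>d / D\<close> by less than
      \<open>C + 1\<close>.\<close>
    define Q where "Q = 1 + C * ((d div D - 1) div C)"
    have dD: "d div D \<ge> C + 2" using d D by (simp add: less_eq_div_iff_mult_less_eq mult.commute)
    have "[Q = 1] (mod fact M)"
      unfolding Q_def C_def unique_euclidean_semiring_class.cong_def by (rule mod_mult_self2)
    then obtain V' :: "('a \<times> (nat \<Rightarrow> int)) set" and S'
      where V': "walk_graph k (D * Q) V' S'" "card V' = card V * Q ^ k"
      using M[of Q] by (auto simp: Q_def)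
    have "C * ((d div D - 1) div C) \<le> d div D - 1" by simp
    then have "Q \<le> d div D" using dD unfolding Q_def by linarith
    then have "D * Q \<le> d" using D by (metis div_times_less_eq_dividend mult.commute mult_le_mono1 order_trans)
    moreover have "V' \<noteq> {}" using V'(2) cV by (auto simp: Q_def)
    ultimately have le: "card V * Q ^ k \<le> degree_diameter_number k d"
      using card_le_degree_diameter_number[OF V'(1)] V'(2) by simp
    have "d div D - 1 < C * ((d div D - 1) div C) + C"
      using C by (metis add.commute div_mult_mod_eq mod_less_divisor mult.commute nat_add_left_cancel_less)
    then have "d div D \<le> Q + C" unfolding Q_def by linarith
    moreover have "real d / D < d div D + 1"
    proof -
      have "d < D * (d div D + 1)" using D dividend_less_times_div[of D d] by (simp add: algebra_simps)
      then have "real d < D * (d div D + 1)" by (simp only: of_nat_less_iff flip: of_nat_mult)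
      then show ?thesis using D by (simp add: field_simps)
    qed
    ultimately have Qge: "real d / D - (C + 2) \<le> Q" by linarith
    \<comment> \<open>The smaller base must be nonnegative for the comparison of \<open>k\<close>-th
      powers.\<close>
    have "C + 2 \<le> real d / D"
    proof -
      have "real (D * (C + 2)) \<le> real d" using d by (simp only: of_nat_le_iff)
      then show ?thesis using D by (simp add: field_simps)
    qed
    then have "(real d / D - (C + 2)) ^ k \<le> real Q ^ k" using Qge by (intro power_mono) auto
    then have "card V * (real d / D - (C + 2)) ^ k \<le> card V * real Q ^ k" by (intro mult_left_mono) auto
    also have "\<dots> = real (card V * Q ^ k)" by simp
    also have "\<dots> \<le> degree_diameter_number k d" unfolding of_nat_le_iff by (rule le)
    finally show ?thesis by (simp add: power_divide divide_right_mono)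
  qed
  have "(\<lambda>d. (real d / D - (C + 2)) / d) \<longlonglongrightarrow> 1 / D"
    using D by (real_asymp simp: inverse_eq_divide)
  then have "(\<lambda>d. card V * ((real d / D - (C + 2)) / d) ^ k) \<longlonglongrightarrow> card V * (1 / D) ^ k"
    by (intro tendsto_mult tendsto_power tendsto_const)
  then have "\<forall>\<^sub>F d in sequentially. c < card V * ((real d / D - (C + 2)) / d) ^ k"
    using lt by (intro order_tendstoD) (simp_all add: D_def power_divide)
  then show ?thesis
    using eventually_ge_at_top[of "D * (C + 2)"] by eventually_elim (use lower in fastforce)
qed

lemma degree_diameter_number_ratio_upper:
  assumes "c > 1"
  shows "\<forall>\<^sub>F d in sequentially. degree_diameter_number k d / real d ^ k < c"
proof -
  have lim: "(\<lambda>d. \<Sum>i\<le>k. real d ^ i / real d ^ k) \<longlonglongrightarrow> (\<Sum>i\<le>k. if i = k then 1 else 0)"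
  proof (intro tendsto_sum)
    fix i assume i: "i \<in> {..k}"
    have ev: "\<forall>\<^sub>F d in sequentially. (1 / real d) ^ (k - i) = real d ^ i / real d ^ k"
      using eventually_gt_at_top[of 0]
    proof eventually_elim
      case (elim d)
      then show ?case using i by (simp add: power_diff power_divide)
    qed
    \<comment> \<open>\<open>0 ^ 0 = 1\<close> singles out the term \<open>i = k\<close>.\<close>
    have "(\<lambda>d. (1 / real d) ^ (k - i)) \<longlonglongrightarrow> 0 ^ (k - i)"
      by (intro tendsto_power) real_asymp
    then have "(\<lambda>d. real d ^ i / real d ^ k) \<longlonglongrightarrow> 0 ^ (k - i)"
      using ev by (rule Lim_transform_eventually)
    moreover have "(0 :: real) ^ (k - i) = (if i = k then 1 else 0)"
      using i by (auto simp: power_0_left)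
    ultimately show "(\<lambda>d. real d ^ i / real d ^ k) \<longlonglongrightarrow> (if i = k then 1 else 0)"
      by simp
  qed
  then have "\<forall>\<^sub>F d in sequentially. (\<Sum>i\<le>k. real d ^ i / real d ^ k) < c"
    using assms by (intro order_tendstoD(2)[OF lim]) simp
  then show ?thesis
  proof eventually_elim
    case (elim d)
    have "real (degree_diameter_number k d) \<le> real (\<Sum>i\<le>k. d ^ i)"
      unfolding of_nat_le_iff by (rule degree_diameter_number_le)
    then have "degree_diameter_number k d \<le> (\<Sum>i\<le>k. real d ^ i)" by simp
    then have "degree_diameter_number k d / real d ^ k \<le> (\<Sum>i\<le>k. real d ^ i) / real d ^ k"
      by (intro divide_right_mono) auto
    then show ?case using elim by (simp add: sum_divide_distrib)
  qed
qed

theorem theorem1p1: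
  fixes k :: nat
  assumes "k \<ge> 1"
  shows "(\<lambda>d. real (degree_diameter_number k d) / real d ^ k) \<longlonglongrightarrow> 1"
proof (rule order_tendstoI)
  fix c :: real
  assume "c > 1"
  then show "\<forall>\<^sub>F d in sequentially. real (degree_diameter_number k d) / real d ^ k < c"
    by (rule degree_diameter_number_ratio_upper)
next
  fix c :: real
  assume c: "c < 1"
  \<comment> \<open>The product below is the lower bound for \<open>card V / D ^ k\<close>, with
    \<open>D = (p + 1) ^ k + k\<close>, that the flag graph yields. It is written in
    \<open>1 / p\<close> so that its limit 1 can be read off factor by factor.\<close>
  have "(\<lambda>p. real p / (real p + 1)) \<longlonglongrightarrow> 1" by real_asymp
  moreover have "(\<lambda>p. (1 + 1 / real p) ^ k + real k * (1 / real p) ^ k) \<longlonglongrightarrow> (1 + 0) ^ k + real k * 0 ^ k"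
    by (intro tendsto_intros lim_1_over_n)
  then have "(\<lambda>p. 1 / ((1 + 1 / real p) ^ k + k * (1 / real p) ^ k)) \<longlonglongrightarrow> 1 / 1"
    using assms by (intro tendsto_divide) (auto simp: power_0_left)
  ultimately have "(\<lambda>p. (real p / (real p + 1)) ^ k * (1 / ((1 + 1 / real p) ^ k + k * (1 / real p) ^ k)) ^ k)
      \<longlonglongrightarrow> 1 ^ k * (1 / 1) ^ k"
    by (intro tendsto_mult tendsto_power)
  then have "\<forall>\<^sub>F p in sequentially.
      c < (real p / (real p + 1)) ^ k * (1 / ((1 + 1 / real p) ^ k + k * (1 / real p) ^ k)) ^ k"
    using c by (intro order_tendstoD) auto
  then obtain p0 where p0: "\<And>p. p \<ge> p0 \<Longrightarrow>
      c < (real p / (real p + 1)) ^ k * (1 / ((1 + 1 / real p) ^ k + k * (1 / real p) ^ k)) ^ k"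
    unfolding eventually_sequentially by blast
  \<comment> \<open>The prime is fixed here, depending only on \<open>c\<close> and
    \<open>k\<close>; \<open>d\<close> then tends to infinity through blow-ups of this one
    graph.\<close>
  obtain p where p: "prime p" "p > p0" using bigger_prime by blast
  then have pos: "p > 0" using prime_gt_0_nat by blast
  obtain V :: "(nat \<Rightarrow> (nat \<Rightarrow> int) set) set" and S
    where V: "walk_graph k ((p + 1) ^ k) V S" "p ^ ((k + 1) * k) \<le> card V * (p + 1) ^ k"
    using flag_walk_graph[OF p(1)] by blast
  have "V \<noteq> {}" using V(2) pos by auto
  define D where "D = (p + 1) ^ k + k"
  have "real (p ^ ((k + 1) * k)) \<le> real (card V * (p + 1) ^ k)"
    unfolding of_nat_le_iff by (rule V(2))
  then have "real p ^ ((k + 1) * k) \<le> card V * (real p + 1) ^ k" by (simp add: add.commute)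
  then have "real p ^ ((k + 1) * k) / (real p + 1) ^ k \<le> card V"
    by (simp add: divide_le_eq)
  then have le: "real p ^ ((k + 1) * k) / (real p + 1) ^ k / real D ^ k \<le> card V / real D ^ k"
    by (intro divide_right_mono) auto
  have "1 / ((1 + 1 / real p) ^ k + k * (1 / real p) ^ k) = real p ^ k / D"
  proof -
    have "(1 + 1 / real p) ^ k + k * (1 / real p) ^ k = D / real p ^ k"
    proof -
      have "1 + 1 / real p = (1 + real p) / real p" using pos by (simp add: field_simps)
      then have "(1 + 1 / real p) ^ k = (1 + real p) ^ k / real p ^ k"
        by (simp only: power_divide)
      then show ?thesis by (simp add: D_def power_divide add_divide_distrib)
    qed
    then show ?thesis by simp
  qed
  moreover have "c < (real p / (real p + 1)) ^ k * (1 / ((1 + 1 / real p) ^ k + k * (1 / real p) ^ k)) ^ k"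
    using p0 p(2) by simp
  ultimately have "c < (real p / (real p + 1)) ^ k * (real p ^ k / D) ^ k" by simp
  also have "\<dots> = real p ^ ((k + 1) * k) / (real p + 1) ^ k / real D ^ k"
    by (simp add: power_divide power_add power_mult)
  finally have "c < card V / real ((p + 1) ^ k + k) ^ k" using le by (simp add: D_def)
  then show "\<forall>\<^sub>F d in sequentially. c < real (degree_diameter_number k d) / real d ^ k"
    using assms by (intro degree_diameter_number_ratio_lower[OF V(1) \<open>V \<noteq> {}\<close>]) auto
qed

end
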